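(* Every clockable ordinal that is not one-tape clockable ends a gap in the clockable ordinals.
   Context: An infinite time Turing machine (ITTM) has three tapes (input, scratch, output) of cells indexed by $\omega$ with values in $\{0,1\}$, one head scanning a column of all three tapes, and a program with finitely many states including start, halt and a limit state. Successor steps are as for ordinary Turing machines (moving left from the leftmost cell leaves the head in place); at limit stages the head returns to the leftmost cell, the state becomes the limit state, and each cell takes the $\limsup$ of its earlier values. A one-tape ITTM is the same with a single tape. An ordinal $\alpha$ is clockable (resp. one-tape clockable) if some ITTM (resp. one-tape ITTM) program on input $0=\langle000\cdots\rangle$ (all cells $0$) reaches the halt state for the first time at exactly stage $\alpha$. A clockable ordinal $\alpha$ ends a gap in the clockable ordinals if there is $\beta<\alpha$ such that no ordinal in $[\beta,\alpha)$ is clockable. *)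

theory Defs
  imports Main
begin

(* Ordinals are modelled as elements of an arbitrary well-ordered type 'a.
   A configuration: (state, head position, tapes); tapes T i x = content of
   cell x of tape i.  A program for a k-tape machine maps (state, symbols read
   on the k tapes) to (symbols written, move right?, new state). *)

type_synonym config = "nat \<times> nat \<times> (nat \<Rightarrow> nat \<Rightarrow> bool)"
type_synonym program = "nat \<Rightarrow> bool list \<Rightarrow> bool list \<times> bool \<times> nat"

definition start_state :: nat where "start_state = 0"
definition halt_state :: nat where "halt_state = 1"
definition limit_state :: nat where "limit_state = 2"

(* a program with finitely many states {0..<n} (n >= 3: start, halt, limit) *)
definition valid_program :: "nat \<Rightarrow> nat \<Rightarrow> program \<Rightarrow> bool" where
  "valid_program k n P \<longleftrightarrow> 3 \<le> n \<and>
     (\<forall>q<n. \<forall>w. length w = k \<longrightarrow>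
        length (fst (P q w)) = k \<and> snd (snd (P q w)) < n)"

(* successor step; moving left from cell 0 leaves the head in place (h - 1 on nat) *)
definition ittm_step :: "nat \<Rightarrow> program \<Rightarrow> config \<Rightarrow> config" where
  "ittm_step k P c = (case c of (q, h, T) \<Rightarrow>
     if q = halt_state then c else
     (case P q (map (\<lambda>i. T i h) [0..<k]) of (w', r, q') \<Rightarrow>
        (q', if r then Suc h else h - 1,
         \<lambda>i x. if i < k \<and> x = h then w' ! i else T i x)))"

definition init_config :: config where
  "init_config = (start_state, 0, \<lambda>i x. False)"

definition limit_config :: "('a::wellorder \<Rightarrow> config) \<Rightarrow> 'a \<Rightarrow> config" where
  "limit_config C \<beta> = (limit_state, 0,
     \<lambda>i x. \<forall>\<gamma><\<beta>. \<exists>\<delta>. \<gamma> \<le> \<delta> \<and> \<delta> < \<beta> \<and> snd (snd (C \<delta>)) i x)"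

definition is_run :: "nat \<Rightarrow> program \<Rightarrow> ('a::wellorder \<Rightarrow> config) \<Rightarrow> bool" where
  "is_run k P C \<longleftrightarrow> (\<forall>\<beta>.
     ((\<forall>\<gamma>. \<not> \<gamma> < \<beta>) \<longrightarrow> C \<beta> = init_config) \<and>
     (\<forall>\<gamma>. \<gamma> < \<beta> \<and> \<not> (\<exists>\<delta>. \<gamma> < \<delta> \<and> \<delta> < \<beta>) \<longrightarrow> C \<beta> = ittm_step k P (C \<gamma>)) \<and>
     ((\<exists>\<gamma>. \<gamma> < \<beta>) \<and> \<not> (\<exists>\<gamma>. \<gamma> < \<beta> \<and> \<not> (\<exists>\<delta>. \<gamma> < \<delta> \<and> \<delta> < \<beta>))
        \<longrightarrow> C \<beta> = limit_config C \<beta>))"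

definition k_tape_clockable :: "nat \<Rightarrow> 'a::wellorder \<Rightarrow> bool" where
  "k_tape_clockable k \<alpha> \<longleftrightarrow> (\<exists>n P C. valid_program k n P \<and> is_run k P C \<and>
     fst (C \<alpha>) = halt_state \<and> (\<forall>\<beta><\<alpha>. fst (C \<beta>) \<noteq> halt_state))"

definition clockable :: "'a::wellorder \<Rightarrow> bool" where
  "clockable \<alpha> \<longleftrightarrow> k_tape_clockable 3 \<alpha>"

definition one_tape_clockable :: "'a::wellorder \<Rightarrow> bool" where
  "one_tape_clockable \<alpha> \<longleftrightarrow> k_tape_clockable 1 \<alpha>"

definition ends_gap :: "'a::wellorder \<Rightarrow> bool" where
  "ends_gap \<alpha> \<longleftrightarrow> clockable \<alpha> \<and>
     (\<exists>\<beta><\<alpha>. \<forall>\<gamma>. \<beta> \<le> \<gamma> \<and> \<gamma> < \<alpha> \<longrightarrow> \<not> clockable \<gamma>)"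

end

theory Submission
  imports Defs
begin

text \<open>
  Since limit stages carry the limit state, a clockable ordinal is \<open>\<lambda> + n\<close> with \<open>n > 0\<close> and
  \<open>\<lambda>\<close> zero or a limit. For a limit \<open>\<lambda>\<close>, whether a machine halts \<open>n\<close> steps after a limit stage
  depends only on the first \<open>n\<close> columns there. A simulation can watch for the pattern of
  these columns at \<open>\<lambda>\<close> with two flags: \<open>A\<close> flashes whenever every cell that has to be 1 has been
  seen to be 1 since the previous flash, and \<open>B\<close> is 1 whenever some cell that has to be 0 is 1.
  At a limit, \<open>A = 1\<close> and \<open>B = 0\<close> says exactly that the pattern has appeared.

  A one-tape machine interleaving all tapes reads \<open>A\<close> and \<open>B\<close> in two steps after a limit, so
  \<open>\<lambda> + 2\<close>, and with it every \<open>\<lambda> + n\<close> with \<open>n \<ge> 2\<close>, is one-tape clockable. If \<open>n = 1\<close> and \<open>\<lambda> + 1\<close>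
  does not end a gap, some clockable \<open>\<beta> < \<lambda>\<close> is so late that the cells that have to be 0 stay 0 from
  \<open>\<beta>\<close> up to \<open>\<lambda>\<close>. Simulating a clock for \<open>\<beta>\<close> alongside and suppressing \<open>A\<close> until it halts makes \<open>B\<close>
  superfluous, so one step after the limit suffices.

  Both simulations take finitely many steps per simulated step, hence are in phase with the
  simulated computation at every limit stage.
\<close>

section \<open>Ordinal stages and transfinite runs\<close>

text \<open>The successor is a junk value on a greatest element of the type, hence the hypotheses of the
  form \<open>s < t\<close> below.\<close>

definition sc :: "'a::wellorder \<Rightarrow> 'a" where
  "sc t = (LEAST s. t < s)"

text \<open>Immediate succession is phrased without \<open>sc\<close>, in the form used by
  \<open>is_run\<close>, so that a greatest element of the type needs no separate treatment.\<close>

definition covers :: "'a::wellorder \<Rightarrow> 'a \<Rightarrow> bool" where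
  "covers t s \<longleftrightarrow> s < t \<and> \<not> (\<exists>d. s < d \<and> d < t)"

definition nonsucc :: "'a::wellorder \<Rightarrow> bool" where
  "nonsucc t \<longleftrightarrow> (\<nexists>s. covers t s)"

definition is_lim :: "'a::wellorder \<Rightarrow> bool" where
  "is_lim t \<longleftrightarrow> (\<exists>s. s < t) \<and> nonsucc t"

definition limsup_at :: "'a::wellorder \<Rightarrow> ('a \<Rightarrow> bool) \<Rightarrow> bool" where
  "limsup_at t f \<longleftrightarrow> (\<forall>g<t. \<exists>d. g \<le> d \<and> d < t \<and> f d)"

lemma sc_greater: "s < t \<Longrightarrow> s < sc s"
  unfolding sc_def by (rule LeastI)

lemma sc_le: "s < t \<Longrightarrow> sc s \<le> t"
  unfolding sc_def by (rule Least_le)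

lemma less_sc_le: "t < sc s \<Longrightarrow> t \<le> s"
  using sc_le[of s t] by (auto simp: not_le[symmetric])

lemma covers_iff: "covers t s \<longleftrightarrow> s < t \<and> t = sc s"
proof
  assume "covers t s"
  then show "s < t \<and> t = sc s"
    unfolding covers_def using sc_greater sc_le by (metis order_le_less)
next
  assume "s < t \<and> t = sc s"
  then show "covers t s"
    unfolding covers_def using sc_le by (metis leD)
qed

lemma covers_sc: "s < t \<Longrightarrow> covers (sc s) s"
  using covers_iff sc_greater by blast

lemma is_lim_sc: "is_lim t \<Longrightarrow> s < t \<Longrightarrow> sc s < t"
  by (metis covers_sc is_lim_def nonsucc_def order_le_less sc_le)

lemma time_cases:
  obtains (zero) "\<forall>s. \<not> s < t" | (succ) s where "s < t" "t = sc s" | (lim) "is_lim t"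
  unfolding is_lim_def nonsucc_def covers_iff by blast

lemma time_induct [case_names zero succ lim]:
  fixes t :: "'a::wellorder"
  assumes "\<And>t. (\<forall>s. \<not> s < t) \<Longrightarrow> Q t"
    and "\<And>s. s < sc s \<Longrightarrow> Q s \<Longrightarrow> Q (sc s)"
    and "\<And>t. is_lim t \<Longrightarrow> (\<And>s. s < t \<Longrightarrow> Q s) \<Longrightarrow> Q t"
  shows "Q t"
proof (induction t rule: less_induct)
  case (less t)
  show ?case by (cases t rule: time_cases) (use assms less in auto)
qed

section \<open>Finite iterates of the successor above a base stage\<close>

lemma iter_sc_lim:
  assumes "is_lim t" "s < t"
  shows "(sc ^^ j) s < t"
  using assms by (induction j) (auto intro: is_lim_sc)

lemma iter_sc_mono:
  assumes "is_lim t" "s < t" "i \<le> j"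
  shows "(sc ^^ i) s \<le> (sc ^^ j) s"
  using assms(3)
proof (induction j)
  case (Suc j)
  have "(sc ^^ j) s < sc ((sc ^^ j) s)"
    using sc_greater iter_sc_lim[OF assms(1,2)] by blast
  then show ?case using Suc by (cases "i = Suc j") auto
qed simp

text \<open>Descending through predecessors stops after finitely many steps, at zero or a limit. The
  last conjunct certifies that none of the \<open>j\<close> successors is the junk value of
  \<open>sc\<close>.\<close>

lemma time_decomp: "\<exists>m j. nonsucc m \<and> m \<le> t \<and> t = (sc ^^ j) m \<and> (\<forall>i<j. (sc ^^ i) m < (sc ^^ Suc i) m)"
proof (induction t rule: less_induct)
  case (less t)
  show ?case
  proof (cases "nonsucc t")
    case True
    then show ?thesis by (intro exI[of _ t] exI[of _ 0]) auto
  next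
    case False
    then obtain s where s: "s < t" "t = sc s" unfolding nonsucc_def covers_iff by blast
    then obtain m j where mj: "nonsucc m" "m \<le> s" "s = (sc ^^ j) m"
      "\<forall>i<j. (sc ^^ i) m < (sc ^^ Suc i) m" using less by blast
    then show ?thesis
      using s by (intro exI[of _ m] exI[of _ "Suc j"]) (auto simp: less_Suc_eq)
  qed
qed

text \<open>No proper successor in the chain can equal \<open>m'\<close>, so the bound on
  \<open>m'\<close> descends step by step to the base.\<close>

lemma nonsucc_le_base:
  assumes "nonsucc m'" "m' \<le> (sc ^^ j) m" "\<forall>i<j. (sc ^^ i) m < (sc ^^ Suc i) m"
  shows "m' \<le> m"
  using assms(2,3)
proof (induction j)
  case (Suc j)
  have lt: "(sc ^^ j) m < (sc ^^ Suc j) m" using Suc by blast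
  then have "covers ((sc ^^ Suc j) m) ((sc ^^ j) m)" by (simp add: covers_iff)
  then have "m' \<noteq> (sc ^^ Suc j) m" using assms(1) unfolding nonsucc_def by blast
  then have "m' \<le> (sc ^^ j) m"
    using Suc.prems(1) sc_le[of "(sc ^^ j) m" m'] by (metis antisym_conv funpow.simps(2) comp_apply not_le)
  then show ?case using Suc by auto
qed simp

text \<open>Compares two sequences block by block, a block being \<open>m\<close>,
  \<open>m + 1\<close>, ... above a \<open>nonsucc\<close> base. If a further block starts between
  \<open>g\<close> and \<open>t\<close>, one occurrence per block suffices (\<open>ex\<close>); if
  the block of \<open>g\<close> is the last one below \<open>t\<close>, occurrences must be infinite
  in number (\<open>inf\<close>).\<close>

lemma limsup_at_transfer:
  assumes nu: "is_lim t" and x: "limsup_at t x"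
    and ex: "\<And>m j. \<lbrakk>nonsucc m; m < t; x ((sc ^^ j) m)\<rbrakk> \<Longrightarrow> \<exists>i. y ((sc ^^ i) m)"
    and inf: "\<And>m N. \<lbrakk>nonsucc m; m < t; \<forall>N. \<exists>j\<ge>N. x ((sc ^^ j) m)\<rbrakk> \<Longrightarrow> \<exists>i\<ge>N. y ((sc ^^ i) m)"
  shows "limsup_at t y"
  unfolding limsup_at_def
proof (intro allI impI)
  fix g assume g: "g < t"
  obtain m k where m: "nonsucc m" "m \<le> g" "g = (sc ^^ k) m"
    "\<forall>i<k. (sc ^^ i) m < (sc ^^ Suc i) m" using time_decomp by blast
  have mt: "m < t" using m(2) g by auto
  show "\<exists>d\<ge>g. d < t \<and> y d"
  proof (cases "\<exists>m'. nonsucc m' \<and> m < m' \<and> m' < t")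
    case True
    then obtain m' where m': "nonsucc m'" "m < m'" "m' < t" by blast
    have gm': "g < m'" using nonsucc_le_base[OF m'(1) _ m(4)] m' m(3) by (meson leD not_le)
    obtain d where d: "m' \<le> d" "d < t" "x d" using x m'(3) unfolding limsup_at_def by blast
    obtain e j where e: "nonsucc e" "e \<le> d" "d = (sc ^^ j) e"
      "\<forall>i<j. (sc ^^ i) e < (sc ^^ Suc i) e" using time_decomp by blast
    have "m' \<le> e" using nonsucc_le_base[OF m'(1) _ e(4)] d e(3) by blast
    moreover have et: "e < t" using e d by auto
    moreover obtain i where i: "y ((sc ^^ i) e)" using ex[OF e(1) et] d(3) e(3) by blast
    ultimately show ?thesis
      using iter_sc_lim[OF nu et, of i] iter_sc_mono[OF nu et, of 0 i] gm'
      by (intro exI[of _ "(sc ^^ i) e"]) auto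
  next
    case False
    have "\<exists>j\<ge>N. x ((sc ^^ j) m)" for N
    proof -
      obtain d where d: "(sc ^^ N) m \<le> d" "d < t" "x d"
        using x iter_sc_lim[OF nu mt] unfolding limsup_at_def by blast
      obtain e j where e: "nonsucc e" "e \<le> d" "d = (sc ^^ j) e"
        "\<forall>i<j. (sc ^^ i) e < (sc ^^ Suc i) e" using time_decomp by blast
      have "m \<le> d" using d iter_sc_mono[OF nu mt, of 0 N] by auto
      then have "m \<le> e" using nonsucc_le_base[OF m(1) _ e(4)] e(3) by blast
      \<comment> \<open>No base lies strictly between \<open>m\<close> and \<open>t\<close>, so
        \<open>d\<close> belongs to the block of \<open>m\<close>.\<close>
      then have em: "e = m" using False e d by (metis antisym_conv2 order_le_less_trans)
      show ?thesis
      proof (cases "N \<le> j")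
        case False
        then have "d \<le> (sc ^^ N) m" using e em iter_sc_mono[OF nu mt, of j N] by auto
        then have "d = (sc ^^ N) m" using d by simp
        then show ?thesis using d by auto
      qed (use d e em in auto)
    qed
    then obtain i where "i \<ge> k" "y ((sc ^^ i) m)" using inf[OF m(1) mt] by blast
    then show ?thesis using m iter_sc_lim[OF nu mt] iter_sc_mono[OF nu mt] by blast
  qed
qed

text \<open>One notion of run serves all machines below: \<open>ob\<close> gives the cells subject
  to the limsup rule, and \<open>lm\<close> rebuilds a full state from their limit contents.\<close>

definition trun :: "'s \<Rightarrow> ('s \<Rightarrow> 's) \<Rightarrow> ('s \<Rightarrow> 'c \<Rightarrow> bool) \<Rightarrow> (('c \<Rightarrow> bool) \<Rightarrow> 's) \<Rightarrow> ('a::wellorder \<Rightarrow> 's) \<Rightarrow> bool" where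
  "trun ini st ob lm R \<longleftrightarrow> (\<forall>t.
     ((\<forall>s. \<not> s < t) \<longrightarrow> R t = ini) \<and>
     (\<forall>s. covers t s \<longrightarrow> R t = st (R s)) \<and>
     (is_lim t \<longrightarrow> R t = lm (\<lambda>c. limsup_at t (\<lambda>d. ob (R d) c))))"

lemma trun_zero: "trun ini st ob lm R \<Longrightarrow> \<forall>s. \<not> s < t \<Longrightarrow> R t = ini"
  and trun_sc: "trun ini st ob lm R \<Longrightarrow> s < u \<Longrightarrow> R (sc s) = st (R s)"
  and trun_lim: "trun ini st ob lm R \<Longrightarrow> is_lim t \<Longrightarrow> R t = lm (\<lambda>c. limsup_at t (\<lambda>d. ob (R d) c))"
  unfolding trun_def by (blast intro: covers_sc)+

lemma trun_iter:
  assumes "trun ini st ob lm R" "is_lim u" "s < u"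
  shows "R ((sc ^^ j) s) = (st ^^ j) (R s)"
  by (induction j) (auto simp: trun_sc[OF assms(1) iter_sc_lim[OF assms(2,3)]])

text \<open>Well-founded recursion on stages: every clause refers to strictly earlier stages only,
  so cutting \<open>R\<close> off at \<open>t\<close> changes nothing.\<close>

lemma trun_exists: "\<exists>R :: 'a::wellorder \<Rightarrow> 's. trun ini st ob lm R"
proof -
  define r :: "('a \<times> 'a) set" where "r = {(s, t). s < t}"
  define F where "F R t = (if \<forall>s. \<not> s < t then ini
      else if \<exists>s. covers t s then st (R (THE s. covers t s))
      else lm (\<lambda>c. limsup_at t (\<lambda>d. ob (R d) c)))" for R :: "'a \<Rightarrow> 's" and t
  have "wf r" unfolding r_def by (rule wf)
  define R where "R = wfrec r F"
  have R: "R t = F (cut R r t) t" for t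
    unfolding R_def by (rule wfrec[OF \<open>wf r\<close>])
  have cut: "cut R r t s = R s" if "s < t" for s t
    using that by (simp add: cut_apply r_def)
  have "trun ini st ob lm R"
    unfolding trun_def
  proof (intro allI conjI impI)
    fix t :: 'a assume "\<forall>s. \<not> s < t"
    then show "R t = ini" by (subst R) (simp add: F_def)
  next
    fix t s :: 'a assume ts: "covers t s"
    have "(THE s. covers t s) = s"
      using ts unfolding covers_def by (intro the_equality) (auto intro: linorder_neqE)
    then show "R t = st (R s)"
      using ts by (subst R) (auto simp: F_def cut covers_def)
  next
    fix t :: 'a assume t: "is_lim t"
    have "limsup_at t (\<lambda>d. ob (cut R r t d) c) = limsup_at t (\<lambda>d. ob (R d) c)" for c
      unfolding limsup_at_def using cut by metis
    then show "R t = lm (\<lambda>c. limsup_at t (\<lambda>d. ob (R d) c))"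
      using t by (subst R) (auto simp: F_def is_lim_def nonsucc_def)
  qed
  then show ?thesis by blast
qed

section \<open>Simulation with finite delays\<close>

text \<open>Paths are nonempty so that successive simulated steps consume strictly increasing
  stages. \<open>I\<close> is demanded of all configurations but the last, which begins the next
  path.\<close>

definition ppath :: "('s \<Rightarrow> 's) \<Rightarrow> ('s \<Rightarrow> bool) \<Rightarrow> 's \<Rightarrow> 's \<Rightarrow> bool" where
  "ppath st I c d \<longleftrightarrow> (\<exists>m>0. (st ^^ m) c = d \<and> (\<forall>i<m. I ((st ^^ i) c)))"

lemma ppath_step: "I c \<Longrightarrow> ppath st I c (st c)"
  unfolding ppath_def by (intro exI[of _ 1]) auto

lemma ppath_trans:
  assumes "ppath st I c d" "ppath st I d e"
  shows "ppath st I c e"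
proof -
  obtain m where m: "m > 0" "(st ^^ m) c = d" "\<forall>i<m. I ((st ^^ i) c)"
    using assms(1) unfolding ppath_def by blast
  obtain l where l: "l > 0" "(st ^^ l) d = e" "\<forall>i<l. I ((st ^^ i) d)"
    using assms(2) unfolding ppath_def by blast
  have "I ((st ^^ i) c)" if "i < m + l" for i
  proof (cases "i < m")
    case False
    then obtain p where p: "i = p + m" using le_Suc_ex[of m i] by (auto simp: add.commute)
    then have "(st ^^ i) c = (st ^^ p) d" using m by (simp add: funpow_add)
    then show ?thesis using l p that by auto
  qed (use m in auto)
  moreover have "(st ^^ (l + m)) c = e" using m l by (simp add: funpow_add)
  ultimately show ?thesis
    unfolding ppath_def using m(1) by (intro exI[of _ "l + m"]) (auto simp: add.commute)
qed

lemma ppath_Cons: "I c \<Longrightarrow> ppath st I (st c) d \<Longrightarrow> ppath st I c d"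
  using ppath_step ppath_trans by metis

lemma strict_mono_bracket:
  assumes "strict_mono (g :: nat \<Rightarrow> nat)" "g 0 = 0"
  obtains j where "g j \<le> i" "i < g (Suc j)"
proof -
  have "i < g (Suc i)" using strict_mono_imp_increasing[OF assms(1), of "Suc i"] by simp
  then have ex: "\<exists>j. i < g (Suc j)" by blast
  define j where "j = (LEAST j. i < g (Suc j))"
  have "i < g (Suc j)" unfolding j_def using ex by (rule LeastI_ex)
  moreover have "g j \<le> i"
  proof (cases j)
    case (Suc j')
    then show ?thesis using not_less_Least[of j' "\<lambda>j. i < g (Suc j)"] j_def by simp
  qed (simp add: assms)
  ultimately show thesis using that by blast
qed

text \<open>Each step of \<open>R1\<close> is simulated by finitely many steps of \<open>R2\<close>, during which a cell may be 1
  only if it is 1 before or after the simulated step; so limits superior agree. The cells in \<open>Z\<close> are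
  auxiliary ones that stay 0 throughout.\<close>

locale refinement =
  fixes R1 :: "'a::wellorder \<Rightarrow> 's" and R2 :: "'a \<Rightarrow> 'r"
    and i1 st1 l1 and ob1 :: "'s \<Rightarrow> 'c \<Rightarrow> bool" and i2 st2 l2 and ob2 :: "'r \<Rightarrow> 'd \<Rightarrow> bool"
    and f :: "'c \<Rightarrow> 'd" and rel :: "'s \<Rightarrow> 'r \<Rightarrow> bool" and N :: "'r \<Rightarrow> bool" and Z :: "'d set"
    and lam :: 'a
  assumes run1: "trun i1 st1 ob1 l1 R1" and run2: "trun i2 st2 ob2 l2 R2"
    and rel_init: "rel i1 i2"
    and rel_lim: "\<And>u1 u2. (\<And>c. u1 c = u2 (f c)) \<Longrightarrow> (\<And>z. z \<in> Z \<Longrightarrow> \<not> u2 z) \<Longrightarrow> rel (l1 u1) (l2 u2)"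
    and rel_ob: "\<And>s1 s2 c. rel s1 s2 \<Longrightarrow> ob2 s2 (f c) = ob1 s1 c"
    and N_Z: "\<And>s z. N s \<Longrightarrow> z \<in> Z \<Longrightarrow> \<not> ob2 s z"
    and sim: "\<And>t s2. t < lam \<Longrightarrow> rel (R1 t) s2 \<Longrightarrow>
      \<exists>s2'. rel (st1 (R1 t)) s2' \<and>
        ppath st2 (\<lambda>s. N s \<and> (\<forall>c. ob2 s (f c) \<longrightarrow> ob1 (R1 t) c \<or> ob1 (st1 (R1 t)) c)) s2 s2'"
begin

text \<open>Dependent choice along the block of \<open>m\<close>: \<open>g j\<close> counts the
  steps of \<open>R2\<close> after which \<open>j\<close> steps of \<open>R1\<close> have been
  simulated.\<close>

lemma interval:
  assumes nu: "is_lim t" "t \<le> lam" and m: "m < t" and rel: "rel (R1 m) (R2 m)"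
  obtains g where "strict_mono g" "g 0 = 0" "\<And>j. rel (R1 ((sc ^^ j) m)) (R2 ((sc ^^ g j) m))"
    "\<And>j i. g j \<le> i \<Longrightarrow> i < g (Suc j) \<Longrightarrow> N (R2 ((sc ^^ i) m))"
    "\<And>j i c. g j \<le> i \<Longrightarrow> i < g (Suc j) \<Longrightarrow> ob2 (R2 ((sc ^^ i) m)) (f c) \<Longrightarrow>
      ob1 (R1 ((sc ^^ j) m)) c \<or> ob1 (R1 ((sc ^^ Suc j) m)) c"
proof -
  let ?X = "\<lambda>j. R1 ((sc ^^ j) m)" and ?Y = "\<lambda>i. R2 ((sc ^^ i) m)"
  have it1: "R1 ((sc ^^ Suc j) m) = st1 (?X j)" for j
    using trun_iter[OF run1 nu(1) m, of "Suc j"] trun_iter[OF run1 nu(1) m, of j] by simp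
  have it2: "(st2 ^^ i) (?Y j) = ?Y (i + j)" for i j
    using trun_iter[OF run2 nu(1) m, of "i + j"] trun_iter[OF run2 nu(1) m, of j] by (simp add: funpow_add)
  have "\<exists>g. \<forall>j. (rel (?X j) (?Y (g j)) \<and> (j = 0 \<longrightarrow> g j = 0)) \<and>
      (g j < g (Suc j) \<and> (\<forall>i. g j \<le> i \<and> i < g (Suc j) \<longrightarrow> N (?Y i) \<and>
        (\<forall>c. ob2 (?Y i) (f c) \<longrightarrow> ob1 (?X j) c \<or> ob1 (?X (Suc j)) c)))"
  proof (rule dependent_nat_choice)
    show "\<exists>x. rel (?X 0) (?Y x) \<and> (0 = (0::nat) \<longrightarrow> x = 0)" using rel by auto
  next
    fix x j assume "rel (?X j) (?Y x) \<and> (j = 0 \<longrightarrow> x = 0)"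
    moreover have "(sc ^^ j) m < lam" using iter_sc_lim[OF nu(1) m, of j] nu(2) by simp
    ultimately obtain s2' where s2': "rel (?X (Suc j)) s2'"
      "ppath st2 (\<lambda>s. N s \<and> (\<forall>c. ob2 s (f c) \<longrightarrow> ob1 (?X j) c \<or> ob1 (?X (Suc j)) c)) (?Y x) s2'"
      using sim[of "(sc ^^ j) m" "?Y x"] it1[of j] by auto
    then obtain l where l: "l > 0" "?Y (l + x) = s2'"
      "\<forall>i<l. N (?Y (i + x)) \<and> (\<forall>c. ob2 (?Y (i + x)) (f c) \<longrightarrow> ob1 (?X j) c \<or> ob1 (?X (Suc j)) c)"
      unfolding ppath_def it2 by blast
    show "\<exists>y. (rel (?X (Suc j)) (?Y y) \<and> (Suc j = 0 \<longrightarrow> y = 0)) \<and>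
      (x < y \<and> (\<forall>i. x \<le> i \<and> i < y \<longrightarrow> N (?Y i) \<and>
        (\<forall>c. ob2 (?Y i) (f c) \<longrightarrow> ob1 (?X j) c \<or> ob1 (?X (Suc j)) c)))"
    proof (intro exI[of _ "l + x"] conjI allI impI)
      fix i assume "x \<le> i \<and> i < l + x"
      then have "i - x < l" "i - x + x = i" by auto
      then show "N (?Y i)" "\<And>c. ob2 (?Y i) (f c) \<Longrightarrow> ob1 (?X j) c \<or> ob1 (?X (Suc j)) c"
        using l(3) by metis+
    qed (use l s2' in auto)
  qed
  then obtain g where g: "\<And>j. rel (?X j) (?Y (g j))" "g 0 = 0" "\<And>j. g j < g (Suc j)"
    "\<And>j i. g j \<le> i \<Longrightarrow> i < g (Suc j) \<Longrightarrow> N (?Y i) \<and>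
        (\<forall>c. ob2 (?Y i) (f c) \<longrightarrow> ob1 (?X j) c \<or> ob1 (?X (Suc j)) c)" by metis
  show thesis
    by (rule that[of g]) (use g in \<open>auto simp: strict_mono_Suc_iff simp del: funpow.simps\<close>)
qed

text \<open>Finite delays never cross a limit stage, so the runs meet again there as soon as the
  limits superior of related cells agree. \<open>limsup_at_transfer\<close> gives this in both
  directions.\<close>

lemma rel_nonsucc:
  assumes lam: "is_lim lam" and "nonsucc m" "m \<le> lam"
  shows "rel (R1 m) (R2 m)"
  using assms(2,3)
proof (induction m rule: less_induct)
  case (less t)
  show ?case
  proof (cases t rule: time_cases)
    case zero
    then show ?thesis using rel_init by (simp add: trun_zero[OF run1] trun_zero[OF run2])
  next
    case (succ s)
    then show ?thesis using less.prems covers_iff nonsucc_def by blast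
  next
    case lim
    have IH: "rel (R1 m) (R2 m)" if "nonsucc m" "m < t" for m
      using less.IH[OF that(2,1)] that less.prems by auto
    have "limsup_at t (\<lambda>d. ob1 (R1 d) c) = limsup_at t (\<lambda>d. ob2 (R2 d) (f c))" for c
    proof
      assume x: "limsup_at t (\<lambda>d. ob1 (R1 d) c)"
      \<comment> \<open>A 1 after \<open>j\<close> simulated steps shows after \<open>g j\<close>
        steps of the simulation, and \<open>g j\<close> is at least \<open>j\<close>.\<close>
      have key: "\<exists>i\<ge>j. ob2 (R2 ((sc ^^ i) m)) (f c)"
        if m: "nonsucc m" and mt: "m < t" and ob: "ob1 (R1 ((sc ^^ j) m)) c" for m j
      proof -
        obtain g where g: "strict_mono g" "\<And>j. rel (R1 ((sc ^^ j) m)) (R2 ((sc ^^ g j) m))"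
          using interval[OF lim less.prems(2) mt IH[OF m mt]] by metis
        show ?thesis
          using strict_mono_imp_increasing[OF g(1), of j] rel_ob[OF g(2)] ob by blast
      qed
      show "limsup_at t (\<lambda>d. ob2 (R2 d) (f c))"
        by (rule limsup_at_transfer[OF lim x]) (meson key order_trans)+
    next
      assume x: "limsup_at t (\<lambda>d. ob2 (R2 d) (f c))"
      \<comment> \<open>A 1 during the simulation of a step shows at one of the two ends of that
        step, and \<open>j\<close> is that end. The bound on \<open>i\<close> holds for both ends
        and prevents \<open>j\<close> from staying bounded while \<open>i\<close> grows.\<close>
      have key: "\<exists>j. i \<le> g (Suc j) \<and> ob1 (R1 ((sc ^^ j) m)) c"
        if g: "strict_mono g" "g 0 = 0"
          "\<And>j i c. g j \<le> i \<Longrightarrow> i < g (Suc j) \<Longrightarrow> ob2 (R2 ((sc ^^ i) m)) (f c) \<Longrightarrow>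
             ob1 (R1 ((sc ^^ j) m)) c \<or> ob1 (R1 ((sc ^^ Suc j) m)) c"
          "ob2 (R2 ((sc ^^ i) m)) (f c)" for m i g
      proof -
        obtain j where j: "g j \<le> i" "i < g (Suc j)" using strict_mono_bracket[OF g(1,2)] by blast
        moreover have "g (Suc j) < g (Suc (Suc j))" using g(1) strict_mono_Suc_iff by blast
        ultimately show ?thesis using g(3)[OF j g(4)] by (meson less_imp_le less_trans)
      qed
      show "limsup_at t (\<lambda>d. ob1 (R1 d) c)"
      proof (rule limsup_at_transfer[OF lim x])
        fix m j assume m: "nonsucc m" "m < t" "ob2 (R2 ((sc ^^ j) m)) (f c)"
        obtain g where "strict_mono g" "g 0 = 0"
          "\<And>j i c. g j \<le> i \<Longrightarrow> i < g (Suc j) \<Longrightarrow> ob2 (R2 ((sc ^^ i) m)) (f c) \<Longrightarrow>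
             ob1 (R1 ((sc ^^ j) m)) c \<or> ob1 (R1 ((sc ^^ Suc j) m)) c"
          using interval[OF lim less.prems(2) m(2) IH[OF m(1,2)]] by metis
        then show "\<exists>i. ob1 (R1 ((sc ^^ i) m)) c" using key m(3) by blast
      next
        fix m n assume m: "nonsucc m" "m < t" "\<forall>n. \<exists>j\<ge>n. ob2 (R2 ((sc ^^ j) m)) (f c)"
        obtain g where g: "strict_mono g" "g 0 = 0"
          "\<And>j i c. g j \<le> i \<Longrightarrow> i < g (Suc j) \<Longrightarrow> ob2 (R2 ((sc ^^ i) m)) (f c) \<Longrightarrow>
             ob1 (R1 ((sc ^^ j) m)) c \<or> ob1 (R1 ((sc ^^ Suc j) m)) c"
          using interval[OF lim less.prems(2) m(2) IH[OF m(1,2)]] by metis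
        \<comment> \<open>Choosing \<open>i\<close> beyond \<open>g (Suc n)\<close> forces
          \<open>n \<le> j\<close> by strict monotonicity of \<open>g\<close>.\<close>
        obtain i where i: "i \<ge> Suc (g (Suc n))" "ob2 (R2 ((sc ^^ i) m)) (f c)" using m(3) by blast
        obtain j where "i \<le> g (Suc j)" "ob1 (R1 ((sc ^^ j) m)) c" using key[OF g(1,2) _ i(2)] g(3) by blast
        moreover have "n \<le> j"
        proof -
          have "g (Suc n) < g (Suc j)" using \<open>i \<le> g (Suc j)\<close> i(1) by simp
          then show ?thesis using strict_mono_less[OF g(1)] by simp
        qed
        ultimately show "\<exists>i\<ge>n. ob1 (R1 ((sc ^^ i) m)) c" by blast
      qed
    qed
    \<comment> \<open>Each stage below \<open>t\<close> lies in a bracketed piece of some block, so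
      \<open>N\<close> holds there; hence cells in \<open>Z\<close> are 0 all along and also in the
      limit.\<close>
    moreover have "\<not> limsup_at t (\<lambda>d. ob2 (R2 d) z)" if z: "z \<in> Z" for z
    proof -
      have "N (R2 d)" if d: "d < t" for d
      proof -
        obtain m i where m: "nonsucc m" "m \<le> d" "d = (sc ^^ i) m" using time_decomp by blast
        then have mt: "m < t" using d by auto
        obtain g where g: "strict_mono g" "g 0 = 0"
          "\<And>j i. g j \<le> i \<Longrightarrow> i < g (Suc j) \<Longrightarrow> N (R2 ((sc ^^ i) m))"
          using interval[OF lim less.prems(2) mt IH[OF m(1) mt]] by metis
        then show ?thesis using strict_mono_bracket[OF g(1,2), of i] m by metis
      qed
      then show ?thesis using N_Z z lim unfolding limsup_at_def is_lim_def by blast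
    qed
    ultimately show ?thesis
      unfolding trun_lim[OF run1 lim] trun_lim[OF run2 lim] by (intro rel_lim) auto
  qed
qed

lemma N_below:
  assumes lam: "is_lim lam" and d: "d < lam"
  shows "N (R2 d)"
proof -
  obtain m i where m: "nonsucc m" "m \<le> d" "d = (sc ^^ i) m" using time_decomp by blast
  then have ml: "m < lam" using d by auto
  obtain g where g: "strict_mono g" "g 0 = 0"
    "\<And>j i. g j \<le> i \<Longrightarrow> i < g (Suc j) \<Longrightarrow> N (R2 ((sc ^^ i) m))"
    using interval[OF lam order_refl ml rel_nonsucc[OF lam m(1)]] ml by (metis less_imp_le)
  then show ?thesis using strict_mono_bracket[OF g(1,2), of i] m by metis
qed

end

section \<open>Interleaving the tapes of a column machine\<close>

text \<open>A machine that reads and writes a whole column at once. It has no halting state; halting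
  is decided by the interleaving.\<close>

definition col_step :: "('s \<Rightarrow> ('i \<Rightarrow> bool) \<Rightarrow> ('i \<Rightarrow> bool) \<times> bool \<times> 's) \<Rightarrow>
    's \<times> nat \<times> ('i \<Rightarrow> nat \<Rightarrow> bool) \<Rightarrow> 's \<times> nat \<times> ('i \<Rightarrow> nat \<Rightarrow> bool)" where
  "col_step \<delta> = (\<lambda>(s, h, T). case \<delta> s (\<lambda>i. T i h) of (c, r, s') \<Rightarrow>
     (s', if r then Suc h else h - 1, \<lambda>i. (T i)(h := c i)))"

definition col_cell :: "'s \<times> nat \<times> ('i \<Rightarrow> nat \<Rightarrow> bool) \<Rightarrow> 'i \<times> nat \<Rightarrow> bool" where
  "col_cell = (\<lambda>(s, h, T) (i, x). T i x)"

definition col_start :: "'s \<Rightarrow> ('i \<times> nat \<Rightarrow> bool) \<Rightarrow> 's \<times> nat \<times> ('i \<Rightarrow> nat \<Rightarrow> bool)" where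
  "col_start s u = (s, 0, \<lambda>i x. u (i, x))"

text \<open>\<open>Rd s bs\<close> has collected the symbols \<open>bs\<close> of the current block;
  \<open>Wt j c r s\<close> is about to write symbol \<open>j\<close> of the new column
  \<open>c\<close>, going left; \<open>Mv j r s\<close> has \<open>j\<close> single moves to go. In
  the last two, \<open>r\<close> and \<open>s\<close> are the direction and the new state.\<close>

datatype ('s, 'i) mstate = Rd 's "bool list" | Wt nat "'i \<Rightarrow> bool" bool 's | Mv nat bool 's | Halt

definition tape_step :: "(('s, 'i) mstate \<Rightarrow> bool \<Rightarrow> bool \<times> bool \<times> ('s, 'i) mstate) \<Rightarrow>
    ('s, 'i) mstate \<times> nat \<times> (nat \<Rightarrow> bool) \<Rightarrow> ('s, 'i) mstate \<times> nat \<times> (nat \<Rightarrow> bool)" where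
  "tape_step d = (\<lambda>(q, h, U). if q = Halt then (q, h, U) else
     (case d q (U h) of (b, r, q') \<Rightarrow> (q', if r then Suc h else h - 1, U(h := b))))"

definition tape_cell :: "'q \<times> nat \<times> (nat \<Rightarrow> bool) \<Rightarrow> nat \<Rightarrow> bool" where
  "tape_cell c = snd (snd c)"

definition tape_start :: "'q \<Rightarrow> (nat \<Rightarrow> bool) \<Rightarrow> 'q \<times> nat \<times> (nat \<Rightarrow> bool)" where
  "tape_start q u = (q, 0, u)"

text \<open>Cell \<open>x\<close> of tape \<open>i\<close> is stored in cell \<open>k * x + idx i\<close>. The head never needs to detect the left end:
  \<open>k\<close> moves to the left from a multiple of \<open>k\<close> are the truncated block move. In the limit state
  the machine halts as soon as the cells read so far spell \<open>w\<close>.\<close>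

locale interleave =
  fixes k :: nat and idx :: "'i::finite \<Rightarrow> nat" and nm :: "nat \<Rightarrow> 'i"
    and \<delta> :: "'s \<Rightarrow> ('i \<Rightarrow> bool) \<Rightarrow> ('i \<Rightarrow> bool) \<times> bool \<times> 's"
    and s_ini s_lim :: 's and w :: "bool list"
  assumes k2: "2 \<le> k" and idx_nm: "\<And>j. j < k \<Longrightarrow> idx (nm j) = j"
    and nm_idx: "\<And>i. nm (idx i) = i" and idx_less: "\<And>i. idx i < k"
    and w_ne: "w \<noteq> []" and w_le: "length w \<le> k"
begin

fun md :: "('s, 'i) mstate \<Rightarrow> bool \<Rightarrow> bool \<times> bool \<times> ('s, 'i) mstate" where
  "md (Rd s bs) b = (if s = s_lim \<and> bs @ [b] = w then (b, True, Halt)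
     else if Suc (length bs) < k then (b, True, Rd s (bs @ [b]))
     else case \<delta> s (\<lambda>i. (bs @ [b]) ! idx i) of (c, r, s') \<Rightarrow>
       (c (nm (k - 1)), False, Wt (k - 2) c r s'))"
| "md (Wt j c r s) b = (c (nm j), j = 0 \<and> r, if j = 0 then Mv (k - 1) r s else Wt (j - 1) c r s)"
| "md (Mv j r s) b = (b, r, if j \<le> 1 then Rd s [] else Mv (j - 1) r s)"
| "md Halt b = (b, True, Halt)"

abbreviation "mstep \<equiv> tape_step md"

definition cell :: "'i \<times> nat \<Rightarrow> nat" where "cell = (\<lambda>(i, x). k * x + idx i)"

definition mrel :: "'s \<times> nat \<times> ('i \<Rightarrow> nat \<Rightarrow> bool) \<Rightarrow> ('s, 'i) mstate \<times> nat \<times> (nat \<Rightarrow> bool) \<Rightarrow> bool" where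
  "mrel = (\<lambda>(s, h, T) (q, p, U). q = Rd s [] \<and> p = k * h \<and> (\<forall>i x. U (k * x + idx i) = T i x))"

lemma cell_block: "k * h \<le> k * x + idx i \<and> k * x + idx i < k * h + k \<longleftrightarrow> x = h"
proof
  assume *: "k * h \<le> k * x + idx i \<and> k * x + idx i < k * h + k"
  have "(k * x + idx i) div k = x" using idx_less[of i] by simp
  moreover have "(k * x + idx i) div k = h"
    using * by (intro div_nat_eqI) (auto simp: mult.commute)
  ultimately show "x = h" by simp
qed (use idx_less[of i] in auto)

text \<open>\<open>stop\<close> rules out that an initial part of the block spells \<open>w\<close>,
  so that no halt interrupts the reading.\<close>

lemma read_path:
  assumes I: "\<And>q p. q \<noteq> Halt \<Longrightarrow> I (q, p, U)"
    and stop: "\<And>j. j < k \<Longrightarrow> s = s_lim \<Longrightarrow> map (\<lambda>j. U (p + j)) [0..<Suc j] \<noteq> w"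
    and j: "j < k" "0 < j"
  shows "ppath mstep I (Rd s [], p, U) (Rd s (map (\<lambda>j. U (p + j)) [0..<j]), p + j, U)"
  using j
proof (induction j)
  case (Suc j)
  let ?c = "(Rd s (map (\<lambda>j. U (p + j)) [0..<j]), p + j, U)"
  have "mstep ?c = (Rd s (map (\<lambda>j. U (p + j)) [0..<Suc j]), p + Suc j, U)"
    using Suc.prems stop[of j] by (auto simp: tape_step_def)
  moreover have "ppath mstep I ?c (mstep ?c)" by (rule ppath_step, rule I) simp
  ultimately have "ppath mstep I ?c (Rd s (map (\<lambda>j. U (p + j)) [0..<Suc j]), p + Suc j, U)"
    by simp
  moreover have "0 < j \<Longrightarrow> ppath mstep I (Rd s [], p, U) ?c" using Suc by simp
  ultimately show ?case using ppath_trans[of mstep I _ ?c] by (cases "j = 0") auto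
qed simp

text \<open>\<open>W j\<close> is the tape on which the positions of the block from \<open>j\<close>
  on hold the new column. Writing goes from right to left; the last reading step has already written
  position \<open>k - 1\<close>.\<close>

lemma write_path:
  assumes I: "\<And>q p j. q \<noteq> Halt \<Longrightarrow> I (q, p, W j)"
    and W: "\<And>j y. W j y = (if p + j \<le> y \<and> y < p + k then c (nm (y - p)) else U y)"
    and j: "Suc j < k"
  shows "ppath mstep I (Wt j c r s, p + j, W (Suc j)) (Mv (k - 1) r s, if r then Suc p else p - 1, W 0)"
  using j
proof (induction j)
  case 0
  have "(p + Suc 0 \<le> y \<and> y < p + k) = (y \<noteq> p \<and> p + 0 \<le> y \<and> y < p + k)" for y
    by arith
  then have "(W (Suc 0))(p := c (nm 0)) = W 0" using 0 by (auto simp: fun_eq_iff W[of 0] W[of "Suc 0"])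
  then have "mstep (Wt 0 c r s, p, W (Suc 0)) = (Mv (k - 1) r s, if r then Suc p else p - 1, W 0)"
    by (simp add: tape_step_def)
  then show ?case using ppath_step[where st = mstep and I = I, of "(Wt 0 c r s, p, W (Suc 0))"] I by simp
next
  case (Suc j)
  have "(p + Suc (Suc j) \<le> y \<and> y < p + k) = (y \<noteq> Suc (p + j) \<and> p + Suc j \<le> y \<and> y < p + k)" for y
    by arith
  then have "(W (Suc (Suc j)))(Suc (p + j) := c (nm (Suc j))) = W (Suc j)"
    using Suc.prems by (auto simp: fun_eq_iff W[of "Suc j"] W[of "Suc (Suc j)"])
  then have st: "mstep (Wt (Suc j) c r s, p + Suc j, W (Suc (Suc j))) = (Wt j c r s, p + j, W (Suc j))"
    by (simp add: tape_step_def)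
  show ?case
    by (rule ppath_Cons) (use I Suc st in auto)
qed

lemma move_path:
  assumes I: "\<And>q p. q \<noteq> Halt \<Longrightarrow> I (q, p, U)" and "0 < j"
  shows "ppath mstep I (Mv j r s, p, U) (Rd s [], if r then p + j else p - j, U)"
  using assms(2)
proof (induction j arbitrary: p)
  case (Suc j)
  show ?case
  proof (cases "j = 0")
    case True
    have "mstep (Mv 1 r s, p, U) = (Rd s [], if r then p + 1 else p - 1, U)"
      by (simp add: tape_step_def)
    moreover have "ppath mstep I (Mv 1 r s, p, U) (mstep (Mv 1 r s, p, U))"
      by (rule ppath_step, rule I) simp
    ultimately show ?thesis by (simp only: True One_nat_def)
  next
    case False
    have st: "mstep (Mv (Suc j) r s, p, U) = (Mv j r s, if r then p + 1 else p - 1, U)"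
      using False by (simp add: tape_step_def)
    have "ppath mstep I (Mv j r s, if r then p + 1 else p - 1, U) (Rd s [], if r then p + Suc j else p - Suc j, U)"
      using Suc.IH[of "if r then p + 1 else p - 1"] False by (simp split: if_splits)
    then show ?thesis by (metis ppath_Cons I st mstate.distinct(11))
  qed
qed simp

text \<open>A pass of reading to the right, one of writing to the left, and \<open>k\<close> moves,
  the first of them made by the last write. At every moment each stored symbol is the old or the new
  one, as \<open>refinement\<close> requires.\<close>

lemma macro_step:
  assumes rel: "mrel (s, h, T) c2"
    and stop: "s = s_lim \<Longrightarrow> map (\<lambda>j. T (nm j) h) [0..<length w] \<noteq> w"
  shows "\<exists>c2'. mrel (col_step \<delta> (s, h, T)) c2' \<and>
    ppath mstep (\<lambda>c. fst c \<noteq> Halt \<and> (\<forall>z. tape_cell c (cell z) \<longrightarrow>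
       col_cell (s, h, T) z \<or> col_cell (col_step \<delta> (s, h, T)) z)) c2 c2'"
    (is "\<exists>c2'. _ \<and> ppath mstep ?I c2 c2'")
proof -
  obtain U where c2: "c2 = (Rd s [], k * h, U)" and U: "\<And>i x. U (k * x + idx i) = T i x"
    using rel by (auto simp: mrel_def)
  have Uj: "U (k * h + j) = T (nm j) h" if "j < k" for j
    using U[of h "nm j"] idx_nm[OF that] by simp
  obtain c r s' where d: "\<delta> s (\<lambda>i. T i h) = (c, r, s')" by (metis prod_cases3)
  define W where "W j = (\<lambda>y. if k * h + j \<le> y \<and> y < k * h + k then c (nm (y - k * h)) else U y)" for j
  have Wc: "W j (k * x + idx i) = (if x = h \<and> j \<le> idx i then c i else T i x)" for j x i
  proof (cases "x = h")
    case True
    then show ?thesis using idx_less[of i] by (simp add: W_def U nm_idx)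
  next
    case False
    then have "\<not> (k * h + j \<le> k * x + idx i \<and> k * x + idx i < k * h + k)"
      using cell_block[of h x i] by auto
    then show ?thesis using False by (simp only: W_def U) auto
  qed
  have st: "col_step \<delta> (s, h, T) = (s', if r then Suc h else h - 1, \<lambda>i. (T i)(h := c i))"
    by (simp add: col_step_def d)
  define I where "I = ?I"
  have IU: "I (q, p, U)" if "q \<noteq> Halt" for q p
    using that by (auto simp: I_def tape_cell_def cell_def U col_cell_def)
  have IW: "I (q, p, W j)" if "q \<noteq> Halt" for q p j
    using that by (auto simp: I_def tape_cell_def cell_def Wc col_cell_def st)
  have stop': "map (\<lambda>j. U (k * h + j)) [0..<Suc j] \<noteq> w" if "j < k" "s = s_lim" for j
  proof
    assume e: "map (\<lambda>j. U (k * h + j)) [0..<Suc j] = w"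
    then have "length w = Suc j" by auto
    moreover have "map (\<lambda>j. U (k * h + j)) [0..<Suc j] = map (\<lambda>j. T (nm j) h) [0..<Suc j]"
      using that(1) by (intro map_cong) (auto simp: Uj)
    ultimately show False using stop[OF that(2)] e by metis
  qed
  let ?bs = "map (\<lambda>j. U (k * h + j)) [0..<k - 1]"
  have p1: "ppath mstep I c2 (Rd s ?bs, k * h + (k - 1), U)"
  proof -
    have k1: "k - 1 < k" "0 < k - 1" using k2 by auto
    show ?thesis unfolding c2 by (rule read_path; rule IU stop' k1; assumption)
  qed
  have bs': "?bs @ [U (k * h + (k - 1))] = map (\<lambda>j. U (k * h + j)) [0..<Suc (k - 1)]" by simp
  then have bs: "?bs @ [U (k * h + (k - 1))] = map (\<lambda>j. T (nm j) h) [0..<k]"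
    using k2 Uj by (auto intro!: map_cong simp del: upt_Suc)
  have col: "(\<lambda>i. map (\<lambda>j. T (nm j) h) [0..<k] ! idx i) = (\<lambda>i. T i h)"
    by (rule ext) (simp add: idx_less nm_idx)
  have W1: "U(k * h + (k - 1) := c (nm (k - 1))) = W (k - 1)"
  proof -
    have "(k * h + (k - 1) \<le> y \<and> y < k * h + k) = (y = k * h + (k - 1))" for y using k2 by arith
    then show ?thesis by (auto simp: W_def fun_eq_iff)
  qed
  have "mstep (Rd s ?bs, k * h + (k - 1), U) = (Wt (k - 2) c r s', k * h + (k - 2), W (k - 1))"
  proof -
    have "\<not> (s = s_lim \<and> ?bs @ [U (k * h + (k - 1))] = w)"
      using stop'[of "k - 1"] k2 bs' by (metis diff_less less_le_trans zero_less_one zero_less_numeral)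
    moreover have "\<not> Suc (length ?bs) < k" using k2 by simp
    ultimately have "md (Rd s ?bs) (U (k * h + (k - 1))) = (c (nm (k - 1)), False, Wt (k - 2) c r s')"
      by (simp only: md.simps bs col d if_False prod.case)
    moreover have "k * h + (k - 1) - 1 = k * h + (k - 2)" using k2 by simp
    ultimately show ?thesis by (simp only: tape_step_def prod.case mstate.distinct if_False W1)
  qed
  then have p2: "ppath mstep I (Rd s ?bs, k * h + (k - 1), U) (Wt (k - 2) c r s', k * h + (k - 2), W (k - 1))"
    using ppath_step[where st = mstep and I = I, of "(Rd s ?bs, k * h + (k - 1), U)"] IU
    by (metis mstate.distinct(5))
  have p3: "ppath mstep I (Wt (k - 2) c r s', k * h + (k - 2), W (k - 1))
      (Mv (k - 1) r s', if r then Suc (k * h) else k * h - 1, W 0)"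
  proof -
    have "Suc (k - 2) = k - 1" "Suc (k - 2) < k" using k2 by auto
    moreover have "ppath mstep I (Wt (k - 2) c r s', k * h + (k - 2), W (Suc (k - 2)))
      (Mv (k - 1) r s', if r then Suc (k * h) else k * h - 1, W 0)"
      by (rule write_path[where U = U]; rule IW \<open>Suc (k - 2) < k\<close> fun_cong[OF W_def]; assumption)
    ultimately show ?thesis by simp
  qed
  have p4: "ppath mstep I (Mv (k - 1) r s', if r then Suc (k * h) else k * h - 1, W 0)
      (Rd s' [], k * (if r then Suc h else h - 1), W 0)"
  proof -
    have "(if r then (if r then Suc (k * h) else k * h - 1) + (k - 1) else (if r then Suc (k * h) else k * h - 1) - (k - 1))
      = k * (if r then Suc h else h - 1)" using k2 by (simp add: diff_mult_distrib2)
    moreover have "0 < k - 1" using k2 by simp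
    then have "ppath mstep I (Mv (k - 1) r s', if r then Suc (k * h) else k * h - 1, W 0)
      (Rd s' [], if r then (if r then Suc (k * h) else k * h - 1) + (k - 1)
         else (if r then Suc (k * h) else k * h - 1) - (k - 1), W 0)"
      by (rule move_path[rotated]) (rule IW)
    ultimately show ?thesis by (simp only:)
  qed
  have "mrel (col_step \<delta> (s, h, T)) (Rd s' [], k * (if r then Suc h else h - 1), W 0)"
    by (auto simp: mrel_def st Wc)
  moreover have "ppath mstep I c2 (Rd s' [], k * (if r then Suc h else h - 1), W 0)"
    by (rule ppath_trans[OF ppath_trans[OF ppath_trans[OF p1 p2] p3] p4])
  ultimately show ?thesis unfolding I_def by blast
qed

text \<open>A proper prefix of \<open>w\<close> differs from \<open>w\<close> in length, so the
  machine reads on; \<open>w_le\<close> keeps the reading within the first block.\<close>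

lemma final_steps:
  assumes "\<And>j. j < length w \<Longrightarrow> U j = w ! j" and "j < length w"
  shows "(mstep ^^ j) (Rd s_lim [], 0, U) = (Rd s_lim (take j w), j, U)"
  using assms(2)
proof (induction j)
  case (Suc j)
  have tk: "take j w @ [U j] = take (Suc j) w" using assms Suc.prems by (simp add: take_Suc_conv_app_nth)
  moreover have "take (Suc j) w \<noteq> w" using Suc.prems by (metis length_take min.absorb4 nat_neq_iff)
  ultimately show ?case using Suc w_le by (auto simp: tape_step_def)
qed simp

lemma final_halt:
  assumes "\<And>j. j < length w \<Longrightarrow> U j = w ! j"
  shows "fst ((mstep ^^ length w) (Rd s_lim [], 0, U)) = Halt"
proof -
  obtain j where j: "length w = Suc j" using w_ne by (cases w) auto
  have "take j w @ [U j] = w" using take_Suc_conv_app_nth[of j w] assms[of j] j by simp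
  then show ?thesis using final_steps[OF assms, of j] j by (simp add: tape_step_def)
qed

text \<open>An instance of \<open>refinement\<close> with \<open>Z\<close> empty and
  \<open>N\<close> saying that the machine has not halted: \<open>before\<close> keeps it running
  below \<open>lam\<close>, and \<open>now\<close> makes it halt exactly \<open>length w\<close>
  steps after \<open>lam\<close>.\<close>

lemma one_tape_run:
  fixes R1 :: "'a::wellorder \<Rightarrow> _" and R2 :: "'a \<Rightarrow> _"
  assumes R1: "trun (col_start s_ini (\<lambda>_. False)) (col_step \<delta>) col_cell (col_start s_lim) R1"
    and R2: "trun (tape_start (Rd s_ini []) (\<lambda>_. False)) mstep tape_cell (tape_start (Rd s_lim [])) R2"
    and lam: "is_lim lam"
    and now: "map (\<lambda>j. col_cell (R1 lam) (nm j, 0)) [0..<length w] = w"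
    and before: "\<And>t. t < lam \<Longrightarrow> fst (R1 t) = s_lim \<Longrightarrow>
        map (\<lambda>j. col_cell (R1 t) (nm j, fst (snd (R1 t)))) [0..<length w] \<noteq> w"
  shows "\<And>t. t < lam \<Longrightarrow> fst (R2 t) \<noteq> Halt"
    and "\<And>j. j < length w \<Longrightarrow> fst ((mstep ^^ j) (R2 lam)) \<noteq> Halt"
    and "fst ((mstep ^^ length w) (R2 lam)) = Halt"
proof -
  interpret refinement R1 R2 "col_start s_ini (\<lambda>_. False)" "col_step \<delta>" "col_start s_lim" col_cell
    "tape_start (Rd s_ini []) (\<lambda>_. False)" mstep "tape_start (Rd s_lim [])" tape_cell
    cell mrel "\<lambda>c. fst c \<noteq> Halt" "{}" lam
  proof
    fix t s2 assume t: "t < lam" "mrel (R1 t) s2"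
    obtain s h T where e: "R1 t = (s, h, T)" by (metis prod_cases3)
    show "\<exists>s2'. mrel (col_step \<delta> (R1 t)) s2' \<and> ppath mstep
             (\<lambda>s. fst s \<noteq> Halt \<and> (\<forall>c. tape_cell s (cell c) \<longrightarrow>
                    col_cell (R1 t) c \<or> col_cell (col_step \<delta> (R1 t)) c)) s2 s2'"
      using macro_step[of s h T s2] t before[OF t(1)] by (simp add: e col_cell_def)
  qed (use R1 R2 in \<open>auto simp: mrel_def col_start_def tape_start_def tape_cell_def col_cell_def cell_def\<close>)
  show "fst (R2 t) \<noteq> Halt" if "t < lam" for t using N_below[OF lam that] .
  have "mrel (R1 lam) (R2 lam)" using rel_nonsucc[OF lam] lam unfolding is_lim_def by blast
  moreover have "fst (R1 lam) = s_lim" "fst (snd (R1 lam)) = 0"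
    using trun_lim[OF R1 lam] by (simp_all add: col_start_def)
  ultimately obtain U where U: "R2 lam = (Rd s_lim [], 0, U)" "\<And>i x. U (k * x + idx i) = col_cell (R1 lam) (i, x)"
    by (cases "R1 lam"; cases "R2 lam") (auto simp: mrel_def col_cell_def)
  have Uw: "U j = w ! j" if "j < length w" for j
  proof -
    have "U j = col_cell (R1 lam) (nm j, 0)" using U(2)[of 0 "nm j"] idx_nm[of j] that w_le by simp
    also have "\<dots> = w ! j" using that by (subst now[symmetric]) simp
    finally show ?thesis .
  qed
  show "fst ((mstep ^^ j) (R2 lam)) \<noteq> Halt" if "j < length w" for j
    using final_steps[OF Uw that] by (simp add: U)
  show "fst ((mstep ^^ length w) (R2 lam)) = Halt" using final_halt[OF Uw] by (simp add: U)
qed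

end

section \<open>Finite successor chains, and machine runs as instances of \<open>trun\<close>\<close>

lemma iter_sc_below:
  assumes "\<forall>j<n. (sc ^^ j) s < (sc ^^ Suc j) s" "t < (sc ^^ n) s"
  shows "t < s \<or> (\<exists>j<n. t = (sc ^^ j) s)"
  using assms
proof (induction n)
  case (Suc n)
  have "t \<le> (sc ^^ n) s" using Suc.prems(2) by (simp add: less_sc_le)
  then consider "t = (sc ^^ n) s" | "t < (sc ^^ n) s" by (auto simp: order_le_less)
  then show ?case
  proof cases
    case 2
    then show ?thesis using Suc.IH Suc.prems(1) by (meson less_SucI)
  qed auto
qed simp

text \<open>Unlike \<open>trun_iter\<close>, this applies above \<open>lam\<close>, where only the
  chain itself guarantees that the successors exist.\<close>

lemma trun_iter_chain:
  assumes "trun ini st ob lm R" "\<forall>j<n. (sc ^^ j) s < (sc ^^ Suc j) s" "j \<le> n"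
  shows "R ((sc ^^ j) s) = (st ^^ j) (R s)"
  using assms(3)
proof (induction j)
  case (Suc j)
  then have "(sc ^^ j) s < (sc ^^ Suc j) s" using assms(2) by auto
  from trun_sc[OF assms(1) this] Suc show ?case by simp
qed simp

lemma is_run_trun:
  "is_run k P C \<longleftrightarrow> trun init_config (ittm_step k P) (\<lambda>c (i, x). snd (snd c) i x)
     (\<lambda>u. (limit_state, 0, \<lambda>i x. u (i, x))) C"
  unfolding is_run_def trun_def covers_def is_lim_def nonsucc_def limit_config_def limsup_at_def by simp

lemma is_run_exists: "\<exists>C :: 'a::wellorder \<Rightarrow> config. is_run k P C"
  unfolding is_run_trun by (rule trun_exists)

section \<open>One-tape clockability\<close>

text \<open>Start, halt and limit state must receive the numbers 0, 1 and 2; the list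
  \<open>xs\<close> prescribes such initial numbers.\<close>

lemma enumerate_finite_set:
  assumes "finite Q" "distinct xs" "set xs \<subseteq> Q"
  obtains e where "bij_betw e Q {..<card Q}" "\<And>i. i < length xs \<Longrightarrow> e (xs ! i) = i"
proof -
  obtain ys where ys: "set ys = Q - set xs" "distinct ys" using finite_distinct_list assms(1) by blast
  let ?zs = "xs @ ys"
  have zs: "distinct ?zs" "set ?zs = Q" using ys assms by auto
  then have len: "length ?zs = card Q" using distinct_card by metis
  have b: "bij_betw (nth ?zs) {..<card Q} Q" by (rule bij_betw_nth) (use zs len in auto)
  let ?e = "inv_into {..<card Q} (nth ?zs)"
  have "?e (xs ! i) = i" if "i < length xs" for i
  proof -
    have "?e (?zs ! i) = i"
      using b len that by (intro inv_into_f_f) (auto simp: bij_betw_def)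
    then show ?thesis using that by (simp add: nth_append)
  qed
  then show thesis using that bij_betw_inv_into[OF b] by blast
qed

lemma coded_one_tape_clockable:
  fixes R :: "'a::wellorder \<Rightarrow> _"
  assumes Q: "finite Q" "Halt \<in> Q" "q0 \<in> Q" "ql \<in> Q" "q0 \<noteq> ql" "q0 \<noteq> Halt" "ql \<noteq> Halt"
    and closed: "\<And>q b. q \<in> Q \<Longrightarrow> snd (snd (d q b)) \<in> Q"
    and R: "trun (tape_start q0 (\<lambda>_. False)) (tape_step d) tape_cell (tape_start ql) R"
    and now: "fst (R a) = Halt" and before: "\<And>t. t < a \<Longrightarrow> fst (R t) \<noteq> Halt"
  shows "one_tape_clockable a"
proof -
  have "distinct [q0, Halt, ql]" "set [q0, Halt, ql] \<subseteq> Q" using Q by auto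
  then obtain e where e: "bij_betw e Q {..<card Q}"
    and e': "\<And>i. i < length [q0, Halt, ql] \<Longrightarrow> e ([q0, Halt, ql] ! i) = i"
    using enumerate_finite_set[OF Q(1)] by blast
  have e0: "e q0 = start_state" "e Halt = halt_state" "e ql = limit_state"
    using e'[of 0] e'[of 1] e'[of 2] by (auto simp: start_state_def halt_state_def limit_state_def)
  have inj: "inj_on e Q" using e by (simp add: bij_betw_def)
  define P where "P q w = (case d (inv_into Q e q) (hd w) of (b, r, q') \<Rightarrow> ([b :: bool], r :: bool, e q'))" for q w
  have card: "3 \<le> card Q"
    using card_mono[of Q "{q0, Halt, ql}"] Q by simp
  have "valid_program 1 (card Q) P"
    unfolding valid_program_def
  proof (intro conjI allI impI card)
    fix q and w :: "bool list" assume q: "q < card Q" "length w = 1"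
    then have "inv_into Q e q \<in> Q" using e by (metis bij_betw_def inv_into_into lessThan_iff)
    then have "snd (snd (d (inv_into Q e q) (hd w))) \<in> Q" using closed by blast
    then show "length (fst (P q w)) = 1" "snd (snd (P q w)) < card Q"
      using bij_betw_apply[OF e] by (auto simp: P_def split: prod.splits)
  qed
  \<comment> \<open>Tape 0 carries the single tape; the other tapes in the configuration type are
    blank.\<close>
  define C where "C t = (e (fst (R t)), fst (snd (R t)), \<lambda>i x. i = (0::nat) \<and> snd (snd (R t)) x)" for t
  have inQ: "fst (R t) \<in> Q" for t
  proof (induction t rule: time_induct)
    case (zero t)
    then show ?case using Q trun_zero[OF R] by (simp add: tape_start_def)
  next
    case (succ t)
    then show ?case using closed
      by (auto simp: trun_sc[OF R succ(1)] tape_step_def split: prod.splits) (metis snd_conv)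
  next
    case (lim t)
    then show ?case using Q trun_lim[OF R] by (simp add: tape_start_def)
  qed
  have "is_run 1 P C"
    unfolding is_run_trun trun_def
  proof (intro allI conjI impI)
    fix t :: 'a assume "\<forall>s. \<not> s < t"
    then show "C t = init_config" by (simp add: C_def trun_zero[OF R] tape_start_def init_config_def e0)
  next
    fix t s :: 'a assume "covers t s"
    then have ts: "s < t" "t = sc s" by (auto simp: covers_iff)
    obtain q h U where q: "R s = (q, h, U)" by (metis prod_cases3)
    have qQ: "q \<in> Q" using inQ[of s] q by simp
    then have "e q = halt_state \<longleftrightarrow> q = Halt" using inj e0 Q by (metis inj_on_eq_iff)
    moreover obtain b r q' where d: "d q (U h) = (b, r, q')" by (metis prod_cases3)
    ultimately show "C t = ittm_step 1 P (C s)"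
      using qQ inj by (auto simp: C_def trun_sc[OF R ts(1)] ts(2) q tape_step_def ittm_step_def P_def
          inv_into_f_f fun_eq_iff)
  next
    fix t :: 'a assume t: "is_lim t"
    \<comment> \<open>Blank tapes stay blank: a limit has an earlier stage, so the limsup of the
      constant 0 is 0 rather than vacuously 1.\<close>
    have "limsup_at t (\<lambda>d. snd (snd (C d)) i x) = (i = 0 \<and> limsup_at t (\<lambda>d. tape_cell (R d) x))" for i x
      using t by (cases "i = 0") (auto simp: C_def limsup_at_def tape_cell_def is_lim_def split: prod.splits)
    then show "C t = (limit_state, 0, \<lambda>i x. limsup_at t (\<lambda>d. case (i, x) of (i, x) \<Rightarrow> snd (snd (C d)) i x))"
      by (simp add: C_def[of t] trun_lim[OF R t] tape_start_def e0)
  qed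
  moreover have "fst (C t) = halt_state \<longleftrightarrow> fst (R t) = Halt" for t
    using inQ[of t] inj e0 Q by (auto simp: C_def split: prod.splits) (metis inj_on_eq_iff)
  ultimately show ?thesis
    unfolding one_tape_clockable_def k_tape_clockable_def
    using \<open>valid_program 1 (card Q) P\<close> now before by blast
qed

lemma (in interleave) interleaved_clockable:
  fixes R1 :: "'a::wellorder \<Rightarrow> _"
  assumes R1: "trun (col_start s_ini (\<lambda>_. False)) (col_step \<delta>) col_cell (col_start s_lim) R1"
    and S: "finite S" "s_ini \<in> S" "s_lim \<in> S" "s_ini \<noteq> s_lim"
    and closed: "\<And>s c. s \<in> S \<Longrightarrow> snd (snd (\<delta> s c)) \<in> S"
    and lam: "is_lim lam"
    and now: "map (\<lambda>j. col_cell (R1 lam) (nm j, 0)) [0..<length w] = w"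
    and before: "\<And>t. t < lam \<Longrightarrow> fst (R1 t) = s_lim \<Longrightarrow>
        map (\<lambda>j. col_cell (R1 t) (nm j, fst (snd (R1 t)))) [0..<length w] \<noteq> w"
    and chain: "\<forall>j<length w. (sc ^^ j) lam < (sc ^^ Suc j) lam"
  shows "one_tape_clockable ((sc ^^ length w) lam)"
proof -
  obtain R2 :: "'a \<Rightarrow> _" where
    R2: "trun (tape_start (Rd s_ini []) (\<lambda>_. False)) mstep tape_cell (tape_start (Rd s_lim [])) R2"
    using trun_exists[of _ mstep tape_cell "tape_start (Rd s_lim [])"] by blast
  note run = one_tape_run[OF R1 R2 lam now before]
  let ?L = "{bs :: bool list. set bs \<subseteq> UNIV \<and> length bs \<le> k}"
  \<comment> \<open>Lists and counters never exceed \<open>k\<close> under \<open>md\<close>, which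
    makes a finite state set closed under it.\<close>
  define Q :: "('s, 'i) mstate set" where "Q = insert Halt ((\<lambda>(s, bs). Rd s bs) ` (S \<times> ?L) \<union>
    (\<lambda>(j, c, r, s). Wt j c r s) ` ({..k} \<times> UNIV \<times> UNIV \<times> S) \<union>
    (\<lambda>(j, r, s). Mv j r s) ` ({..k} \<times> UNIV \<times> S))"
  have L: "finite ?L" by (rule finite_lists_length_le) simp
  have "finite Q" unfolding Q_def using S L by (intro finite.insertI finite_UnI finite_imageI finite_cartesian_product) auto
  have mem: "Rd s bs \<in> Q \<longleftrightarrow> s \<in> S \<and> length bs \<le> k" "Wt j c r s \<in> Q \<longleftrightarrow> j \<le> k \<and> s \<in> S"
    "Mv j r s \<in> Q \<longleftrightarrow> j \<le> k \<and> s \<in> S" "Halt \<in> Q" for s bs j c r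
    by (auto simp: Q_def image_iff)
  have cl: "snd (snd (md q b)) \<in> Q" if "q \<in> Q" for q b
    using that
    by (cases q) (use closed in \<open>auto simp: mem split: prod.splits\<close>, (metis snd_conv)+)
  show ?thesis
  proof (rule coded_one_tape_clockable[OF \<open>finite Q\<close> _ _ _ _ _ _ _ R2])
    fix t assume "t < (sc ^^ length w) lam"
    then have "t < lam \<or> (\<exists>j<length w. t = (sc ^^ j) lam)" using iter_sc_below chain by blast
    then show "fst (R2 t) \<noteq> Halt" using run trun_iter_chain[OF R2 chain] by fastforce
  qed (use S cl run trun_iter_chain[OF R2 chain] in \<open>auto simp: mem\<close>)
qed

text \<open>The old halting state is renamed to the fresh state \<open>n\<close>, from which one
  further step halts.\<close>

lemma one_tape_clockable_sc:
  fixes s :: "'a::wellorder"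
  assumes "one_tape_clockable s" "s < u"
  shows "one_tape_clockable (sc s)"
proof -
  obtain n P and C :: "'a \<Rightarrow> config" where P: "valid_program 1 n P" and C: "is_run 1 P C"
    and now: "fst (C s) = halt_state" and before: "\<forall>t<s. fst (C t) \<noteq> halt_state"
    using assms(1) unfolding one_tape_clockable_def k_tape_clockable_def by blast
  note C = C[unfolded is_run_trun]
  have n: "3 \<le> n" using P by (simp add: valid_program_def)
  define ren where "ren q = (if q = halt_state then n else q)" for q
  define P' where "P' q w = (if q = n then (w, False, halt_state)
    else (fst (P q w), fst (snd (P q w)), ren (snd (snd (P q w)))))" for q and w :: "bool list"
  have "valid_program 1 (Suc n) P'"
    using P n unfolding valid_program_def P'_def ren_def halt_state_def
    by (auto simp: less_Suc_eq split: prod.splits)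
  obtain C' :: "'a \<Rightarrow> config" where C': "is_run 1 P' C'"
    using is_run_exists by blast
  note C'' = C'[unfolded is_run_trun]
  have eq: "t \<le> s \<longrightarrow> C' t = (ren (fst (C t)), snd (C t)) \<and> fst (C t) < n" for t
  proof (induction t rule: time_induct)
    case (zero t)
    then show ?case using n trun_zero[OF C] trun_zero[OF C'']
      by (simp add: init_config_def ren_def start_state_def halt_state_def)
  next
    case (succ t)
    show ?case
    proof
      assume "sc t \<le> s"
      then have ts: "t < s" using succ(1) by simp
      obtain q h T where c: "C t = (q, h, T)" by (metis prod_cases3)
      have q: "q \<noteq> halt_state" "q < n" using before ts succ(2) c by force+
      have c': "C' t = (q, h, T)" using succ(2) ts q c by (auto simp: ren_def)
      obtain w' r q' where d: "P q [T 0 h] = (w', r, q')" by (metis prod_cases3)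
      have "q' < n" using P q(2) d unfolding valid_program_def by (metis length_Cons list.size(3) One_nat_def snd_conv)
      then show "C' (sc t) = (ren (fst (C (sc t))), snd (C (sc t))) \<and> fst (C (sc t)) < n"
        using q by (simp add: trun_sc[OF C succ(1)] trun_sc[OF C'' succ(1)] c c' ittm_step_def d P'_def)
    qed
  next
    case (lim t)
    have "limsup_at t (\<lambda>d. snd (snd (C' d)) i x) = limsup_at t (\<lambda>d. snd (snd (C d)) i x)" if "t \<le> s" for i x
      unfolding limsup_at_def using lim(2) that by (metis dual_order.strict_implies_order order.strict_trans2 snd_conv)
    then show ?case using n
      by (auto simp: trun_lim[OF C lim(1)] trun_lim[OF C'' lim(1)] ren_def limit_state_def halt_state_def)
  qed
  have "C' (sc s) = ittm_step 1 P' (C' s)" by (rule trun_sc[OF C'' assms(2)])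
  moreover have "fst (C' s) = n" using eq now by (simp add: ren_def)
  ultimately have "fst (C' (sc s)) = halt_state"
    using n by (cases "C' s") (auto simp: ittm_step_def P'_def halt_state_def)
  moreover have "fst (C' t) \<noteq> halt_state" if "t < sc s" for t
  proof -
    have "t \<le> s" using that by (rule less_sc_le)
    then show ?thesis using eq[of t] n by (auto simp: ren_def halt_state_def)
  qed
  ultimately show ?thesis
    unfolding one_tape_clockable_def k_tape_clockable_def
    using C' \<open>valid_program 1 (Suc n) P'\<close> by blast
qed

lemma one_tape_clockable_one:
  fixes s :: "'a::wellorder"
  assumes "\<forall>t. \<not> t < s" "s < u"
  shows "one_tape_clockable (sc s)"
proof -
  define P where "P q w = (w, False, halt_state)" for q :: nat and w :: "bool list"
  obtain C :: "'a \<Rightarrow> config" where C: "is_run 1 P C"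
    using is_run_exists by blast
  note C' = C[unfolded is_run_trun]
  have "valid_program 1 3 P" by (simp add: valid_program_def P_def halt_state_def)
  moreover have Cs: "C s = init_config" by (rule trun_zero[OF C' assms(1)])
  then have "fst (C (sc s)) = halt_state"
    by (simp add: trun_sc[OF C' assms(2)] ittm_step_def P_def init_config_def start_state_def halt_state_def)
  moreover have "fst (C t) \<noteq> halt_state" if "t < sc s" for t
  proof -
    have "t \<le> s" using that by (rule less_sc_le)
    then have "t = s" using assms(1) by (simp add: order_le_less)
    then show ?thesis by (simp add: Cs init_config_def start_state_def halt_state_def)
  qed
  ultimately show ?thesis
    unfolding one_tape_clockable_def k_tape_clockable_def using C by blast
qed

section \<open>A machine watching two computations\<close>

datatype three = A0 | A1 | A2

fun t3 :: "three \<Rightarrow> nat" where "t3 A0 = 0" | "t3 A1 = 1" | "t3 A2 = 2"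

text \<open>\<open>FA\<close> and \<open>FB\<close> hold the flags \<open>A\<close> and \<open>B\<close> in column 0, \<open>FD\<close> records there that the gate has opened,
  \<open>Tp \<theta> a\<close> are the tapes of thread \<open>\<theta>\<close> (\<open>False\<close>: the watched machine, \<open>True\<close>: the clock), and \<open>Sn a\<close>
  marks the cells seen to be 1 since the last flash.\<close>

datatype dtape = FA | FB | FD | Tp bool three | Sn three

text \<open>\<open>Le\<close> marks the left end. The simulated head of thread \<open>\<theta>\<close> is at the first 0 of \<open>Off \<theta>\<close>: whatever lies to
  the right of it is irrelevant, so at a limit writing 0 in column 0 resets the head without
  any clearing.\<close>

datatype tape = Off bool | Le | Dat dtape

text \<open>The phases of a round: \<open>Obs x g b\<close> scans from column \<open>x\<close> with
  partial verdicts \<open>g\<close> (all required ones seen) and \<open>b\<close> (a forbidden one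
  present), \<open>Wr\<close> writes the flags, \<open>Upd f x\<close> updates the marks
  \<open>Sn\<close>, and \<open>Find \<theta>\<close>, \<open>Place \<theta>\<close> carry out one
  step of a thread. \<open>Boot\<close> opens the first round after the start or a limit.\<close>

datatype phase = Boot | Obs nat bool bool | Wr bool bool | Upd bool nat | Find bool | Place bool

instance three :: finite
proof
  have "(UNIV :: three set) \<subseteq> {A0, A1, A2}" by (auto intro: three.exhaust)
  then show "finite (UNIV :: three set)" by (rule finite_subset) simp
qed

instance dtape :: finite
proof
  have "x \<in> {FA, FB, FD} \<union> range (\<lambda>(b, a). Tp b a) \<union> range Sn" for x by (cases x) auto
  then have "(UNIV :: dtape set) \<subseteq> {FA, FB, FD} \<union> range (\<lambda>(b, a). Tp b a) \<union> range Sn" by blast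
  then show "finite (UNIV :: dtape set)" by (rule finite_subset) simp
qed

instance tape :: finite
proof
  have "x \<in> {Le} \<union> range Off \<union> range Dat" for x by (cases x) auto
  then have "(UNIV :: tape set) \<subseteq> {Le} \<union> range Off \<union> range Dat" by blast
  then show "finite (UNIV :: tape set)" by (rule finite_subset) simp
qed

text \<open>The first component says that the head is returning to the left end before
  the phase starts.\<close>

type_synonym control = "bool \<times> phase \<times> (bool \<Rightarrow> nat)"
type_synonym vconfig = "(bool \<Rightarrow> nat) \<times> (bool \<Rightarrow> nat) \<times> (dtape \<Rightarrow> nat \<Rightarrow> bool)"

text \<open>Searching for a simulated head in column 0 takes no step, which \<open>ppath\<close>
  excludes.\<close>

definition rpath :: "('s \<Rightarrow> 's) \<Rightarrow> ('s \<Rightarrow> bool) \<Rightarrow> 's \<Rightarrow> 's \<Rightarrow> bool" where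
  "rpath st I c d \<longleftrightarrow> c = d \<or> ppath st I c d"

lemma rpath_ppath: "rpath st I c d \<Longrightarrow> ppath st I d e \<Longrightarrow> ppath st I c e"
  unfolding rpath_def using ppath_trans by metis

lemma ppath_single: "st c = d \<Longrightarrow> I c \<Longrightarrow> ppath st I c d"
  using ppath_step by metis

lemma ppath_next: "st c = c' \<Longrightarrow> ppath st I c' d \<Longrightarrow> I c \<Longrightarrow> ppath st I c d"
  using ppath_Cons by metis

lemma ppath_mono:
  assumes "ppath st I c d" "\<And>s. I s \<Longrightarrow> I' s"
  shows "ppath st I' c d"
proof -
  obtain m where "m > 0" "(st ^^ m) c = d" "\<forall>i<m. I ((st ^^ i) c)"
    using assms(1) unfolding ppath_def by blast
  then show ?thesis unfolding ppath_def using assms(2) by (intro exI[of _ m]) simp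
qed

text \<open>\<open>pr\<close> gives the programs of the two threads, \<open>Pos\<close> the pattern
  awaited on the first \<open>n\<close> columns, and \<open>G\<close> the states of the clock that
  open the gate.\<close>

locale watcher =
  fixes pr :: "bool \<Rightarrow> program" and n :: nat and Pos :: "three \<Rightarrow> nat \<Rightarrow> bool" and G :: "nat \<Rightarrow> bool"
  assumes n_pos: "0 < n"
begin

definition out :: "bool \<Rightarrow> vconfig \<Rightarrow> bool list \<times> bool \<times> nat" where
  "out \<theta> = (\<lambda>(s, h, T). pr \<theta> (s \<theta>) [T (Tp \<theta> A0) (h \<theta>), T (Tp \<theta> A1) (h \<theta>), T (Tp \<theta> A2) (h \<theta>)])"

definition gate :: "vconfig \<Rightarrow> bool" where
  "gate = (\<lambda>(s, h, T). T FD 0 \<or> G (s True))"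

definition good :: "vconfig \<Rightarrow> bool" where
  "good = (\<lambda>(s, h, T). \<forall>a. \<forall>x<n. Pos a x \<longrightarrow> T (Sn a) x \<or> T (Tp False a) x)"

definition bad :: "vconfig \<Rightarrow> bool" where
  "bad = (\<lambda>(s, h, T). \<exists>a. \<exists>x<n. \<not> Pos a x \<and> T (Tp False a) x)"

definition flash :: "vconfig \<Rightarrow> bool" where
  "flash v \<longleftrightarrow> good v \<and> gate v"

definition vtape :: "vconfig \<Rightarrow> dtape \<Rightarrow> nat \<Rightarrow> bool" where
  "vtape v = snd (snd v)"

text \<open>Everything is computed from the configuration before the step. A flash erases the marks
  even of cells that are 1 at that moment, so each flash needs observations later than the previous
  one.\<close>

definition next_tape :: "vconfig \<Rightarrow> dtape \<Rightarrow> nat \<Rightarrow> bool" where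
  "next_tape v d x = (case d of
      FA \<Rightarrow> if x = 0 then flash v else vtape v FA x
    | FB \<Rightarrow> if x = 0 then bad v else vtape v FB x
    | FD \<Rightarrow> if x = 0 then gate v else vtape v FD x
    | Sn a \<Rightarrow> if x < n then \<not> flash v \<and> (vtape v (Sn a) x \<or> vtape v (Tp False a) x) else vtape v (Sn a) x
    | Tp \<theta> a \<Rightarrow> if x = fst (snd v) \<theta> then fst (out \<theta> v) ! t3 a else vtape v (Tp \<theta> a) x)"

text \<open>The threads run on after halting; this is harmless since their halting is all that matters.\<close>

definition vstep :: "vconfig \<Rightarrow> vconfig" where
  "vstep v = (\<lambda>\<theta>. snd (snd (out \<theta> v)),
     \<lambda>\<theta>. if fst (snd (out \<theta> v)) then Suc (fst (snd v) \<theta>) else fst (snd v) \<theta> - 1, next_tape v)"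

definition vcell :: "vconfig \<Rightarrow> dtape \<times> nat \<Rightarrow> bool" where
  "vcell v = (\<lambda>(d, x). vtape v d x)"

definition vstart :: "nat \<Rightarrow> (dtape \<times> nat \<Rightarrow> bool) \<Rightarrow> vconfig" where
  "vstart q u = (\<lambda>_. q, \<lambda>_. 0, \<lambda>d x. u (d, x))"

text \<open>Flags and marks are updated before the threads move, hence from the old thread tapes.
  \<open>Find\<close> writes the direction itself on \<open>Off\<close>: 1 extends the initial run
  of ones past the old head position, 0 ends it there; \<open>Place\<close> then puts a 0 at the new
  position.\<close>

fun kd :: "control \<Rightarrow> (tape \<Rightarrow> bool) \<Rightarrow> (tape \<Rightarrow> bool) \<times> bool \<times> control" where
  "kd (True, f, s) c = (c, False, \<not> c Le, f, s)"
| "kd (False, Boot, s) c = (c(Le := True, Off False := False, Off True := False), False, False, Obs 0 True False, s)"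
| "kd (False, Obs x g b, s) c =
    (let g' = (g \<and> (\<forall>a. Pos a x \<longrightarrow> c (Dat (Sn a)) \<or> c (Dat (Tp False a))));
         b' = (b \<or> (\<exists>a. \<not> Pos a x \<and> c (Dat (Tp False a))))
     in (c, Suc x < n, if Suc x < n then (False, Obs (Suc x) g' b', s) else (True, Wr g' b', s)))"
| "kd (False, Wr g b, s) c =
    (let e = (c (Dat FD) \<or> G (s True))
     in (c(Dat FA := g \<and> e, Dat FB := b, Dat FD := e), False, False, Upd (g \<and> e) 0, s))"
| "kd (False, Upd f x, s) c =
    (\<lambda>t. case t of Dat (Sn a) \<Rightarrow> \<not> f \<and> (c (Dat (Sn a)) \<or> c (Dat (Tp False a))) | _ \<Rightarrow> c t, Suc x < n,
     if Suc x < n then (False, Upd f (Suc x), s) else (True, Find False, s))"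
| "kd (False, Find \<theta>, s) c =
    (if c (Off \<theta>) then (c, True, False, Find \<theta>, s)
     else case pr \<theta> (s \<theta>) [c (Dat (Tp \<theta> A0)), c (Dat (Tp \<theta> A1)), c (Dat (Tp \<theta> A2))] of (w, r, q) \<Rightarrow>
       (\<lambda>t. if t = Off \<theta> then r else case t of Dat (Tp \<eta> a) \<Rightarrow> if \<eta> = \<theta> then w ! t3 a else c t | _ \<Rightarrow> c t,
        r, False, Place \<theta>, s(\<theta> := q)))"
| "kd (False, Place \<theta>, s) c =
    (c(Off \<theta> := False), False, True, if \<theta> then Obs 0 True False else Find True, s)"

abbreviation "kstep \<equiv> col_step kd"

definition marked :: "(tape \<Rightarrow> nat \<Rightarrow> bool) \<Rightarrow> bool \<Rightarrow> nat \<Rightarrow> bool" where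
  "marked K \<theta> h \<longleftrightarrow> (\<forall>x<h. K (Off \<theta>) x) \<and> \<not> K (Off \<theta>) h"

text \<open>A round starts either just after the start or a limit, with both heads at 0 and
  arbitrary contents of \<open>Off\<close>, or after another round, with correct marks.\<close>

definition krel :: "vconfig \<Rightarrow> control \<times> nat \<times> (tape \<Rightarrow> nat \<Rightarrow> bool) \<Rightarrow> bool" where
  "krel = (\<lambda>(s, h, T) (c, p, K). p = 0 \<and> (\<forall>d x. K (Dat d) x = T d x) \<and> (\<forall>x>0. \<not> K Le x) \<and>
     (c = (False, Boot, s) \<and> h = (\<lambda>_. 0) \<or>
      c = (False, Obs 0 True False, s) \<and> K Le 0 \<and> (\<forall>\<theta>. marked K \<theta> (h \<theta>))))"

text \<open>The cell bound required by \<open>sim\<close> in \<open>refinement\<close>, together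
  with the invariant that \<open>Le\<close> marks no column other than 0.\<close>

definition between :: "vconfig \<Rightarrow> vconfig \<Rightarrow> (tape \<Rightarrow> nat \<Rightarrow> bool) \<Rightarrow> bool" where
  "between v v' K \<longleftrightarrow> (\<forall>x>0. \<not> K Le x) \<and> (\<forall>d x. K (Dat d) x \<longrightarrow> vtape v d x \<or> vtape v' d x)"

abbreviation "along v v' \<equiv> (\<lambda>(q, p, K). between v v' K)"

section \<open>The phases of one round\<close>

lemma return_path:
  assumes "between v v' K" "K Le 0"
  shows "ppath kstep (along v v') ((True, f, s), p, K) ((False, f, s), 0, K)"
proof (induction p)
  case 0
  show ?case by (rule ppath_single) (use assms in \<open>auto simp: col_step_def\<close>)
next
  case (Suc p)
  have "\<not> K Le (Suc p)" using assms by (simp add: between_def)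
  then have "kstep ((True, f, s), Suc p, K) = ((True, f, s), p, K)" by (simp add: col_step_def)
  from ppath_next[OF this Suc] show ?case using assms by simp
qed

lemma observe_path:
  assumes K: "between v v' K" "K Le 0"
    and A: "\<And>y. A y = (\<forall>a. Pos a y \<longrightarrow> K (Dat (Sn a)) y \<or> K (Dat (Tp False a)) y)"
    and B: "\<And>y. B y = (\<exists>a. \<not> Pos a y \<and> K (Dat (Tp False a)) y)"
    and x: "x < n"
  shows "ppath kstep (along v v') ((False, Obs x g b, s), x, K)
    ((False, Wr (g \<and> (\<forall>y\<in>{x..<n}. A y)) (b \<or> (\<exists>y\<in>{x..<n}. B y)), s), 0, K)"
  using x
proof (induction "n - x" arbitrary: x g b)
  case (Suc m)
  have le: "{x..<n} = insert x {Suc x..<n}" using Suc.prems by auto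
  have st: "kstep ((False, Obs x g b, s), x, K) =
     (if Suc x < n then ((False, Obs (Suc x) (g \<and> A x) (b \<or> B x), s), Suc x, K)
      else ((True, Wr (g \<and> A x) (b \<or> B x), s), x - 1, K))"
    by (simp add: col_step_def Let_def A B)
  show ?case
  proof (cases "Suc x < n")
    case True
    then have "ppath kstep (along v v') ((False, Obs (Suc x) (g \<and> A x) (b \<or> B x), s), Suc x, K)
      ((False, Wr ((g \<and> A x) \<and> (\<forall>y\<in>{Suc x..<n}. A y)) ((b \<or> B x) \<or> (\<exists>y\<in>{Suc x..<n}. B y)), s), 0, K)"
      using Suc.hyps(2) by (intro Suc.hyps(1)) auto
    then have "ppath kstep (along v v') ((False, Obs x g b, s), x, K)
      ((False, Wr ((g \<and> A x) \<and> (\<forall>y\<in>{Suc x..<n}. A y)) ((b \<or> B x) \<or> (\<exists>y\<in>{Suc x..<n}. B y)), s), 0, K)"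
      by (rule ppath_next[rotated]) (use st True K in simp_all)
    then show ?thesis unfolding le by (simp only: ball_simps bex_simps conj_assoc disj_assoc)
  next
    case False
    then have e: "{Suc x..<n} = {}" by simp
    have "ppath kstep (along v v') ((True, Wr (g \<and> A x) (b \<or> B x), s), x - 1, K)
      ((False, Wr (g \<and> A x) (b \<or> B x), s), 0, K)"
      by (rule return_path[OF K])
    then have "ppath kstep (along v v') ((False, Obs x g b, s), x, K) ((False, Wr (g \<and> A x) (b \<or> B x), s), 0, K)"
      by (rule ppath_next[rotated]) (use st False K in simp_all)
    then show ?thesis unfolding le e by simp
  qed
qed simp

lemma update_path:
  assumes U: "\<And>j t y. U j t y = (case t of Dat (Sn a) \<Rightarrow>
      if y < j then \<not> f \<and> (K (Dat (Sn a)) y \<or> K (Dat (Tp False a)) y) else K t y | _ \<Rightarrow> K t y)"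
    and J: "\<And>j. j \<le> n \<Longrightarrow> between v v' (U j)" and L: "K Le 0" and x: "x < n"
  shows "ppath kstep (along v v') ((False, Upd f x, s), x, U x) ((False, Find False, s), 0, U n)"
  using x
proof (induction "n - x" arbitrary: x)
  case (Suc m)
  have Ux: "(\<lambda>i. (U x i)(x := fst (kd (False, Upd f x, s) (\<lambda>i. U x i x)) i)) = U (Suc x)"
    by (rule ext, rule ext) (auto simp: U less_Suc_eq split: tape.splits dtape.splits)
  have st: "kstep ((False, Upd f x, s), x, U x) =
    (if Suc x < n then ((False, Upd f (Suc x), s), Suc x, U (Suc x)) else ((True, Find False, s), x - 1, U (Suc x)))"
    using Ux by (simp add: col_step_def)
  show ?case
  proof (cases "Suc x < n")
    case True
    have "ppath kstep (along v v') ((False, Upd f (Suc x), s), Suc x, U (Suc x)) ((False, Find False, s), 0, U n)"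
      using Suc.hyps(2) True by (intro Suc.hyps(1)) auto
    then show ?thesis by (rule ppath_next[rotated]) (use st True J[of x] in simp_all)
  next
    case False
    then have n: "n = Suc x" using Suc.prems by simp
    have "ppath kstep (along v v') ((True, Find False, s), x - 1, U n) ((False, Find False, s), 0, U n)"
      by (rule return_path) (use J L in \<open>simp_all add: U\<close>)
    then show ?thesis by (rule ppath_next[rotated]) (use st False J[of x] n in simp_all)
  qed
qed simp

lemma find_path:
  assumes "between v v' K" "\<forall>x<h. K (Off \<theta>) x"
  shows "rpath kstep (along v v') ((False, Find \<theta>, s), 0, K) ((False, Find \<theta>, s), h, K)"
  using assms(2)
proof (induction h)
  case (Suc h)
  have "kstep ((False, Find \<theta>, s), h, K) = ((False, Find \<theta>, s), Suc h, K)"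
    using Suc.prems by (simp add: col_step_def)
  then have p: "ppath kstep (along v v') ((False, Find \<theta>, s), h, K) ((False, Find \<theta>, s), Suc h, K)"
    by (rule ppath_single) (use assms(1) in simp)
  have r: "rpath kstep (along v v') ((False, Find \<theta>, s), 0, K) ((False, Find \<theta>, s), h, K)"
    using Suc by simp
  show ?case unfolding rpath_def by (rule disjI2, rule rpath_ppath[OF r p])
qed (simp add: rpath_def)

lemma thread_path:
  assumes K: "between v v' K" "K Le 0" and m: "marked K \<theta> h"
    and o: "pr \<theta> (s \<theta>) [K (Dat (Tp \<theta> A0)) h, K (Dat (Tp \<theta> A1)) h, K (Dat (Tp \<theta> A2)) h] = (w, r, q)"
    and J: "\<And>a. w ! t3 a \<Longrightarrow> vtape v (Tp \<theta> a) h \<or> vtape v' (Tp \<theta> a) h"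
  obtains K' where
    "ppath kstep (along v v') ((False, Find \<theta>, s), 0, K)
       ((False, if \<theta> then Obs 0 True False else Find True, s(\<theta> := q)), 0, K')"
    "between v v' K'" "\<And>x. K' Le x = K Le x" "marked K' \<theta> (if r then Suc h else h - 1)"
    "\<And>x. K' (Off (\<not> \<theta>)) x = K (Off (\<not> \<theta>)) x"
    "\<And>d x. K' (Dat d) x = (case d of Tp \<eta> a \<Rightarrow> if \<eta> = \<theta> \<and> x = h then w ! t3 a else K (Dat d) x | _ \<Rightarrow> K (Dat d) x)"
proof -
  let ?h = "if r then Suc h else h - 1"
  \<comment> \<open>\<open>K1\<close> is the tape left by the last \<open>Find\<close> step,
    \<open>K'\<close> the one left by \<open>Place\<close>.\<close>
  define K1 where "K1 t x = (if x = h then (if t = Off \<theta> then r else case t of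
     Dat (Tp \<eta> a) \<Rightarrow> if \<eta> = \<theta> then w ! t3 a else K t x | _ \<Rightarrow> K t x) else K t x)" for t x
  define K' where "K' t x = (if t = Off \<theta> \<and> x = ?h then False else K1 t x)" for t x
  have d1: "K1 (Dat d) x = (case d of Tp \<eta> a \<Rightarrow> if \<eta> = \<theta> \<and> x = h then w ! t3 a else K (Dat d) x | _ \<Rightarrow> K (Dat d) x)" for d x
    by (auto simp: K1_def split: dtape.splits)
  have d': "K' (Dat d) x = K1 (Dat d) x" "K' Le x = K Le x" "K1 Le x = K Le x" for d x
    by (auto simp: K'_def K1_def)
  have "vtape v d x \<or> vtape v' d x" if "K1 (Dat d) x" for d x
  proof (cases "\<exists>a. d = Tp \<theta> a \<and> x = h")
    case True
    then obtain a where "d = Tp \<theta> a" "x = h" by blast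
    then show ?thesis using J[of a] that by (simp add: d1)
  next
    case False
    then have "K (Dat d) x" using that by (cases d) (auto simp: d1 split: if_splits)
    then show ?thesis using K(1) unfolding between_def by blast
  qed
  then have J1: "between v v' K1" using K(1) by (simp add: between_def d')
  then have J': "between v v' K'" by (simp add: between_def d')
  have "kstep ((False, Find \<theta>, s), h, K) = ((False, Place \<theta>, s(\<theta> := q)), ?h, K1)"
    using m o by (auto simp: col_step_def marked_def K1_def fun_eq_iff)
  then have p2: "ppath kstep (along v v') ((False, Find \<theta>, s), h, K) ((False, Place \<theta>, s(\<theta> := q)), ?h, K1)"
    using K by (intro ppath_single) auto
  have "kstep ((False, Place \<theta>, s(\<theta> := q)), ?h, K1) =
      ((True, if \<theta> then Obs 0 True False else Find True, s(\<theta> := q)), ?h - 1, K')"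
    by (auto simp: col_step_def K'_def fun_eq_iff)
  then have p3: "ppath kstep (along v v') ((False, Place \<theta>, s(\<theta> := q)), ?h, K1)
      ((True, if \<theta> then Obs 0 True False else Find True, s(\<theta> := q)), ?h - 1, K')"
    using J1 by (intro ppath_single) auto
  have p4: "ppath kstep (along v v') ((True, if \<theta> then Obs 0 True False else Find True, s(\<theta> := q)), ?h - 1, K')
      ((False, if \<theta> then Obs 0 True False else Find True, s(\<theta> := q)), 0, K')"
    by (rule return_path) (use J' K d' in auto)
  have p1: "rpath kstep (along v v') ((False, Find \<theta>, s), 0, K) ((False, Find \<theta>, s), h, K)"
    by (rule find_path) (use K m in \<open>auto simp: marked_def\<close>)
  have "marked K' \<theta> ?h" using m by (auto simp: marked_def K'_def K1_def)
  moreover have "K' (Off (\<not> \<theta>)) x = K (Off (\<not> \<theta>)) x" for x by (auto simp: K'_def K1_def)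
  ultimately show thesis
    using that[of K'] rpath_ppath[OF p1 ppath_trans[OF ppath_trans[OF p2 p3] p4]] J' d' d1 by auto
qed

text \<open>The phases are chained. The threads own disjoint tapes, untouched by flags and marks, so
  the second thread still reads the symbols from before the round.\<close>

lemma watch_path:
  assumes v: "v = (s, h, T)"
    and KT: "\<And>d x. K (Dat d) x = T d x" and Le: "\<forall>x>0. \<not> K Le x" "K Le 0"
    and m: "\<And>\<theta>. marked K \<theta> (h \<theta>)"
  shows "\<exists>c. krel (vstep v) c \<and> ppath kstep (along v (vstep v)) ((False, Obs 0 True False, s), 0, K) c"
proof -
  let ?v' = "vstep v"
  have vT: "vtape v = T" by (simp add: v vtape_def)
  have nT: "vtape ?v' = next_tape v" by (simp add: vtape_def vstep_def)
  have J0: "between v ?v' K" using Le by (simp add: between_def KT vT)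
  have p1: "ppath kstep (along v ?v') ((False, Obs 0 True False, s), 0, K) ((False, Wr (good v) (bad v), s), 0, K)"
  proof -
    have "good v = (True \<and> (\<forall>y\<in>{0..<n}. \<forall>a. Pos a y \<longrightarrow> K (Dat (Sn a)) y \<or> K (Dat (Tp False a)) y))"
      by (auto simp: good_def v KT) blast
    moreover have "bad v = (False \<or> (\<exists>y\<in>{0..<n}. \<exists>a. \<not> Pos a y \<and> K (Dat (Tp False a)) y))"
      by (auto simp: bad_def v KT) blast
    ultimately show ?thesis
      using observe_path[OF J0 Le(2) refl refl n_pos, of True False s] by (simp only:)
  qed
  define K1 where "K1 t x = (if x = 0 \<and> t = Dat FA then flash v else if x = 0 \<and> t = Dat FB then bad v
     else if x = 0 \<and> t = Dat FD then gate v else K t x)" for t x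
  have "kstep ((False, Wr (good v) (bad v), s), 0, K) = ((False, Upd (flash v) 0, s), 0, K1)"
    by (auto simp: col_step_def Let_def K1_def fun_eq_iff flash_def gate_def v KT)
  then have p2: "ppath kstep (along v ?v') ((False, Wr (good v) (bad v), s), 0, K) ((False, Upd (flash v) 0, s), 0, K1)"
    using J0 by (intro ppath_single) auto
  define U where "U j t y = (case t of Dat (Sn a) \<Rightarrow>
      if y < j then \<not> flash v \<and> (K1 (Dat (Sn a)) y \<or> K1 (Dat (Tp False a)) y) else K1 t y | _ \<Rightarrow> K1 t y)" for j t y
  have K1S: "K1 (Dat (Sn a)) y = T (Sn a) y" "K1 (Dat (Tp \<theta> a)) y = T (Tp \<theta> a) y"
    "K1 Le y = K Le y" "K1 (Off \<theta>) y = K (Off \<theta>) y" for a \<theta> y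
    by (auto simp: K1_def KT)
  have UD: "U j (Dat d) y = (case d of FA \<Rightarrow> next_tape v FA y | FB \<Rightarrow> next_tape v FB y | FD \<Rightarrow> next_tape v FD y
     | Tp \<theta> a \<Rightarrow> T (Tp \<theta> a) y
     | Sn a \<Rightarrow> if y < j then \<not> flash v \<and> (T (Sn a) y \<or> T (Tp False a) y) else T (Sn a) y)" for j d y
    by (auto simp: U_def K1S next_tape_def vT split: dtape.splits) (auto simp: K1_def KT)
  have UL: "U j Le y = K Le y" "U j (Off \<theta>) y = K (Off \<theta>) y" for j y \<theta> by (auto simp: U_def K1S)
  have JU: "between v ?v' (U j)" if "j \<le> n" for j
    using that Le by (auto simp: between_def UD UL vT nT next_tape_def split: dtape.splits if_splits)
  have U0: "U 0 = K1" by (auto simp: U_def fun_eq_iff split: tape.splits dtape.splits)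
  have p3: "ppath kstep (along v ?v') ((False, Upd (flash v) 0, s), 0, K1) ((False, Find False, s), 0, U n)"
  proof -
    have "ppath kstep (along v ?v') ((False, Upd (flash v) 0, s), 0, U 0) ((False, Find False, s), 0, U n)"
      by (rule update_path[where K = K1]; (rule U_def | erule JU | simp only: K1S Le(2) n_pos))
    then show ?thesis using U0 by simp
  qed
  obtain w r q where o: "out False v = (w, r, q)" by (metis prod_cases3)
  obtain w' r' q' where o': "out True v = (w', r', q')" by (metis prod_cases3)
  obtain K2 where K2:
    "ppath kstep (along v ?v') ((False, Find False, s), 0, U n) ((False, Find True, s(False := q)), 0, K2)"
    "between v ?v' K2" "\<And>x. K2 Le x = U n Le x" "marked K2 False (if r then Suc (h False) else h False - 1)"
    "\<And>x. K2 (Off True) x = U n (Off True) x"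
    "\<And>d x. K2 (Dat d) x = (case d of Tp \<eta> a \<Rightarrow> if \<eta> = False \<and> x = h False then w ! t3 a else U n (Dat d) x | _ \<Rightarrow> U n (Dat d) x)"
  proof (rule thread_path[of v ?v' "U n" False "h False" s w r q])
    show "w ! t3 a \<Longrightarrow> vtape v (Tp False a) (h False) \<or> vtape ?v' (Tp False a) (h False)" for a
      by (simp add: nT next_tape_def o) (simp add: v)
  qed (use JU Le m o in \<open>auto simp: UL UD marked_def out_def v\<close>)
  have a1: "w' ! t3 a \<Longrightarrow> vtape v (Tp True a) (h True) \<or> vtape ?v' (Tp True a) (h True)" for a
    by (simp add: nT next_tape_def o') (simp add: v)
  have a2: "K2 Le 0" using K2(3) Le(2) by (simp add: UL)
  have a3: "marked K2 True (h True)" using m[of True] K2(5) by (simp add: UL marked_def)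
  have a4: "pr True ((s(False := q)) True) [K2 (Dat (Tp True A0)) (h True), K2 (Dat (Tp True A1)) (h True),
        K2 (Dat (Tp True A2)) (h True)] = (w', r', q')"
    using o' by (simp add: K2(6) UD out_def v)
  obtain K3 where K3':
    "ppath kstep (along v ?v') ((False, Find True, s(False := q)), 0, K2)
       ((False, if True then Obs 0 True False else Find True, s(False := q, True := q')), 0, K3)"
    and K3: "between v ?v' K3" "\<And>x. K3 Le x = K2 Le x" "marked K3 True (if r' then Suc (h True) else h True - 1)"
    "\<And>x. K3 (Off (\<not> True)) x = K2 (Off (\<not> True)) x"
    "\<And>d x. K3 (Dat d) x = (case d of Tp \<eta> a \<Rightarrow> if \<eta> = True \<and> x = h True then w' ! t3 a else K2 (Dat d) x | _ \<Rightarrow> K2 (Dat d) x)"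
    by (rule thread_path[of v ?v' K2 True "h True" "s(False := q)" w' r' q', OF K2(2) a2 a3 a4]) (erule a1, rule that)
  note p5 = K3'[unfolded if_True]
  have hv: "fst (snd v) = h" by (simp add: v)
  have dat: "K3 (Dat d) x = next_tape v d x" for d x
  proof (cases d)
    case (Tp \<theta> a)
    then show ?thesis by (cases \<theta>) (simp_all add: hv K3(5) K2(6) UD next_tape_def o o' vT)
  qed (simp_all add: K3(5) K2(6) UD next_tape_def vT)
  have "marked K3 False (if r then Suc (h False) else h False - 1)" using K2(4) K3(4) by (simp add: marked_def)
  moreover have "fst (snd ?v') False = (if r then Suc (h False) else h False - 1)"
    "fst (snd ?v') True = (if r' then Suc (h True) else h True - 1)"
    by (simp_all add: vstep_def o o' hv)
  ultimately have "\<forall>\<theta>. marked K3 \<theta> (fst (snd ?v') \<theta>)"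
    using K3(3) unfolding all_bool_eq by (simp only: simp_thms)
  moreover have "fst ?v' = s(False := q, True := q')" by (auto simp: vstep_def o o' fun_eq_iff)
  moreover have "snd (snd ?v') = next_tape v" by (simp add: vstep_def)
  ultimately have "krel ?v' ((False, Obs 0 True False, s(False := q, True := q')), 0, K3)"
    using dat K3(2) K2(3) UL Le by (cases ?v') (simp add: krel_def)
  moreover note ppath_trans[OF ppath_trans[OF ppath_trans[OF ppath_trans[OF p1 p2] p3] K2(1)] p5]
  ultimately show ?thesis by blast
qed

text \<open>The extra \<open>Boot\<close> step writes the left end mark and a 0 in column 0 of both
  \<open>Off\<close> tapes, which reduces the first alternative of \<open>krel\<close> to the
  second.\<close>

lemma krel_sim:
  assumes "krel v c"
  shows "\<exists>c'. krel (vstep v) c' \<and> ppath kstep (along v (vstep v)) c c'"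
proof -
  obtain s h T where v: "v = (s, h, T)" by (metis prod_cases3)
  obtain q K where c: "c = (q, 0, K)" and KT: "\<And>d x. K (Dat d) x = T d x" and Le: "\<forall>x>0. \<not> K Le x"
    and alt: "q = (False, Boot, s) \<and> h = (\<lambda>_. 0) \<or>
      q = (False, Obs 0 True False, s) \<and> K Le 0 \<and> (\<forall>\<theta>. marked K \<theta> (h \<theta>))"
    using assms by (cases c) (auto simp: krel_def v)
  from alt show ?thesis
  proof
    assume boot: "q = (False, Boot, s) \<and> h = (\<lambda>_. 0)"
    define K1 where "K1 t x = (if x = 0 \<and> t = Le then True else if x = 0 \<and> (\<exists>\<theta>. t = Off \<theta>) then False else K t x)" for t x
    have "\<exists>c. krel (vstep v) c \<and> ppath kstep (along v (vstep v)) ((False, Obs 0 True False, s), 0, K1) c"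
      by (rule watch_path[OF v]) (use Le boot in \<open>auto simp: K1_def KT marked_def\<close>)
    moreover have "kstep c = ((False, Obs 0 True False, s), 0, K1)"
      using boot by (auto simp: c col_step_def K1_def fun_eq_iff)
    moreover have "along v (vstep v) c"
      using Le by (simp add: c between_def KT v vtape_def)
    ultimately show ?thesis using ppath_next[of kstep c _ "along v (vstep v)"] by metis
  next
    assume "q = (False, Obs 0 True False, s) \<and> K Le 0 \<and> (\<forall>\<theta>. marked K \<theta> (h \<theta>))"
    then show ?thesis using watch_path[OF v KT Le] c by simp
  qed
qed

text \<open>\<open>Z\<close> collects the cells of \<open>Le\<close> beyond column 0: they are 0 at
  limits too, so rewinding cannot stop early.\<close>

lemma watcher_refinement:
  fixes R1 :: "'a::wellorder \<Rightarrow> vconfig" and R2 :: "'a \<Rightarrow> _"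
  assumes R1: "trun (vstart start_state (\<lambda>_. False)) vstep vcell (vstart limit_state) R1"
    and R2: "trun (col_start (False, Boot, \<lambda>_. start_state) (\<lambda>_. False)) kstep col_cell
      (col_start (False, Boot, \<lambda>_. limit_state)) R2"
    and lam: "is_lim lam"
  shows "col_cell (R2 lam) (Dat d, x) = vtape (R1 lam) d x"
proof -
  interpret refinement R1 R2 "vstart start_state (\<lambda>_. False)" vstep "vstart limit_state" vcell
    "col_start (False, Boot, \<lambda>_. start_state) (\<lambda>_. False)" kstep "col_start (False, Boot, \<lambda>_. limit_state)" col_cell
    "\<lambda>(d, x). (Dat d, x)" krel "\<lambda>(q, p, K). \<forall>x>0. \<not> K Le x" "{(Le, x) | x. x > 0}" lam
  proof
    fix t c assume "krel (R1 t) c"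
    then obtain c' where c': "krel (vstep (R1 t)) c'" "ppath kstep (along (R1 t) (vstep (R1 t))) c c'"
      using krel_sim by blast
    moreover have "ppath kstep (\<lambda>s. (case s of (q, p, K) \<Rightarrow> \<forall>x>0. \<not> K Le x) \<and>
         (\<forall>c. col_cell s (case c of (d, x) \<Rightarrow> (Dat d, x)) \<longrightarrow> vcell (R1 t) c \<or> vcell (vstep (R1 t)) c)) c c'"
      by (rule ppath_mono[OF c'(2)]) (auto simp: between_def col_cell_def vcell_def)
    ultimately show "\<exists>s2'. krel (vstep (R1 t)) s2' \<and> ppath kstep (\<lambda>s. (case s of (q, p, K) \<Rightarrow> \<forall>x>0. \<not> K Le x) \<and>
         (\<forall>c. col_cell s (case c of (d, x) \<Rightarrow> (Dat d, x)) \<longrightarrow> vcell (R1 t) c \<or> vcell (vstep (R1 t)) c)) c s2'"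
      by blast
  qed (use R1 R2 in \<open>auto simp: krel_def vstart_def col_start_def col_cell_def vcell_def vtape_def\<close>)
  have "krel (R1 lam) (R2 lam)" using rel_nonsucc[OF lam] lam unfolding is_lim_def by blast
  then show ?thesis by (auto simp: krel_def col_cell_def vtape_def split: prod.splits)
qed

end

section \<open>The flags at limit stages\<close>

context watcher
begin

lemma bad_iff: "bad v \<longleftrightarrow> (\<exists>a. \<exists>x<n. \<not> Pos a x \<and> vtape v (Tp False a) x)"
  and good_iff: "good v \<longleftrightarrow> (\<forall>a. \<forall>x<n. Pos a x \<longrightarrow> vtape v (Sn a) x \<or> vtape v (Tp False a) x)"
  and gate_iff: "gate v \<longleftrightarrow> vtape v FD 0 \<or> G (fst v True)"
  by (cases v, simp add: bad_def good_def gate_def vtape_def)+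

end

locale watcher_run = watcher +
  fixes R :: "'a::wellorder \<Rightarrow> vconfig"
  assumes run: "trun (vstart start_state (\<lambda>_. False)) vstep vcell (vstart limit_state) R"
begin

lemma zero_tape: "\<forall>s. \<not> s < t \<Longrightarrow> \<not> vtape (R t) d x"
  by (simp add: trun_zero[OF run] vstart_def vtape_def)

lemma sc_tape: "s < u \<Longrightarrow> vtape (R (sc s)) d x = next_tape (R s) d x"
  by (simp add: trun_sc[OF run] vstep_def vtape_def)

lemma lim_tape: "is_lim t \<Longrightarrow> vtape (R t) d x = limsup_at t (\<lambda>u. vtape (R u) d x)"
  by (subst trun_lim[OF run]) (simp_all add: vstart_def vtape_def vcell_def)

lemma lim_tapeE:
  assumes "is_lim t" "vtape (R t) d x" "g < t"
  obtains u where "g < u" "u < t" "vtape (R u) d x"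
proof -
  have "sc g < t" using assms is_lim_sc by blast
  then obtain u where "sc g \<le> u" "u < t" "vtape (R u) d x"
    using assms(1,2) unfolding lim_tape[OF assms(1)] limsup_at_def by blast
  moreover have "g < sc g" using assms(3) by (rule sc_greater)
  ultimately show thesis using that by (meson less_le_trans)
qed

text \<open>Agreement includes the first halting stage, since \<open>nh\<close> concerns earlier
  stages only; beyond it \<open>C\<close> freezes while the thread runs on.\<close>

lemma thread_agrees:
  assumes C: "is_run 3 (pr \<theta>) C" and nh: "\<forall>u<t. fst (C u) \<noteq> halt_state"
  shows "fst (R t) \<theta> = fst (C t) \<and> fst (snd (R t)) \<theta> = fst (snd (C t)) \<and>
    (\<forall>a x. vtape (R t) (Tp \<theta> a) x = snd (snd (C t)) (t3 a) x)"
  using nh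
proof (induction t rule: time_induct)
  case (zero t)
  note C = C[unfolded is_run_trun]
  show ?case using zero by (simp add: trun_zero[OF run] trun_zero[OF C] init_config_def vstart_def vtape_def)
next
  case (succ s)
  note C = C[unfolded is_run_trun]
  have IH: "fst (R s) \<theta> = fst (C s)" "fst (snd (R s)) \<theta> = fst (snd (C s))"
    "\<And>a x. vtape (R s) (Tp \<theta> a) x = snd (snd (C s)) (t3 a) x"
    using succ.IH succ.prems succ.hyps by (meson less_trans)+
  have nh: "fst (C s) \<noteq> halt_state" using succ by blast
  obtain q h T where c: "C s = (q, h, T)" by (metis prod_cases3)
  obtain s' h' T' where v: "R s = (s', h', T')" by (metis prod_cases3)
  have up: "[0..<3] = [0, Suc 0, 2]" by (simp add: upt_rec)
  obtain w r q' where o: "pr \<theta> q [T 0 h, T (Suc 0) h, T 2 h] = (w, r, q')" by (metis prod_cases3)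
  have "T' (Tp \<theta> a) x = T (t3 a) x" for a x using IH(3)[of a x] by (simp add: v c vtape_def)
  then have o': "out \<theta> (R s) = (w, r, q')" using IH(1,2) o by (simp add: out_def v c)
  have st: "C (sc s) = (q', if r then Suc h else h - 1, \<lambda>i x. if i < 3 \<and> x = h then w ! i else T i x)"
    using nh by (simp add: trun_sc[OF C succ(1)] ittm_step_def c up o)
  have "t3 a < 3" for a by (cases a) auto
  then show ?case
    using IH by (simp add: st trun_sc[OF run succ(1)] vstep_def o' vtape_def[of "(_, _)"] next_tape_def c)
next
  case (lim t)
  note C = C[unfolded is_run_trun]
  have IH: "vtape (R s) (Tp \<theta> a) x = snd (snd (C s)) (t3 a) x" if "s < t" for s a x
    using lim that by (meson less_trans)
  have "limsup_at t (\<lambda>u. vtape (R u) (Tp \<theta> a) x) = limsup_at t (\<lambda>u. snd (snd (C u)) (t3 a) x)" for a x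
    unfolding limsup_at_def using IH by metis
  then have "vtape (R t) (Tp \<theta> a) x = snd (snd (C t)) (t3 a) x" for a x
    by (simp add: lim_tape[OF lim(1)] trun_lim[OF C lim(1)])
  moreover have "fst (R t) \<theta> = limit_state" "fst (snd (R t)) \<theta> = 0"
    by (simp_all add: trun_lim[OF run lim(1)] vstart_def)
  ultimately show ?case by (simp add: trun_lim[OF C lim(1)])
qed

text \<open>No mark survives the flash, so one present later stems from an observation strictly
  after it.\<close>

lemma seen_since_flash:
  assumes "flash (R u)" "x < n" "u < t" "vtape (R t) (Sn a) x"
  shows "\<exists>v. u < v \<and> v < t \<and> vtape (R v) (Tp False a) x"
  using assms(3,4)
proof (induction t rule: time_induct)
  case (zero t)
  then show ?case by simp
next
  case (succ s)
  have "u \<le> s" using succ.prems(1) by (rule less_sc_le)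
  have "\<not> flash (R s)" and *: "vtape (R s) (Sn a) x \<or> vtape (R s) (Tp False a) x"
    using succ.prems(2) assms(2) by (simp_all add: sc_tape[OF succ(1)] next_tape_def)
  then have "u < s" using assms(1) \<open>u \<le> s\<close> by (metis order_le_less)
  then show ?case using * succ.IH succ.hyps by (meson less_trans)
next
  case (lim t)
  obtain v where "u < v" "v < t" "vtape (R v) (Sn a) x" using lim_tapeE[OF lim(1,4,3)] by blast
  then show ?case using lim.IH by (meson less_trans)
qed

text \<open>The flag at a successor reports on the preceding stage and at a limit is inherited from
  stages above \<open>g\<close>; induction traces it back to a flash.\<close>

lemma flag_A_flash:
  assumes "vtape (R t) FA 0" "g < t"
  shows "\<exists>u. g \<le> u \<and> u < t \<and> flash (R u)"
  using assms
proof (induction t rule: time_induct)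
  case (zero t)
  then show ?case by simp
next
  case (succ s)
  then show ?case using less_sc_le[of g s] by (auto simp: sc_tape[OF succ(1)] next_tape_def)
next
  case (lim t)
  obtain v where "g < v" "v < t" "vtape (R v) FA 0" using lim_tapeE[OF lim(1,3,4)] by blast
  then show ?case using lim.IH by (meson less_trans)
qed

lemma flag_B_bad:
  assumes "vtape (R t) FB 0" "g < t"
  shows "\<exists>u. g \<le> u \<and> u < t \<and> bad (R u)"
  using assms
proof (induction t rule: time_induct)
  case (zero t)
  then show ?case by simp
next
  case (succ s)
  then show ?case using less_sc_le[of g s] by (auto simp: sc_tape[OF succ(1)] next_tape_def)
next
  case (lim t)
  obtain v where "g < v" "v < t" "vtape (R v) FB 0" using lim_tapeE[OF lim(1,3,4)] by blast
  then show ?case using lim.IH by (meson less_trans)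
qed

lemma bad_flag_B:
  assumes t: "is_lim t" and "x < n" "\<not> Pos a x" "vtape (R t) (Tp False a) x"
  shows "vtape (R t) FB 0"
  unfolding lim_tape[OF t] limsup_at_def
proof (intro allI impI)
  fix g assume "g < t"
  then obtain u where u: "g < u" "u < t" "vtape (R u) (Tp False a) x" using lim_tapeE[OF t assms(4)] by blast
  then have "bad (R u)" using assms unfolding bad_iff by blast
  then have "vtape (R (sc u)) FB 0" by (simp add: sc_tape[OF u(2)] next_tape_def)
  moreover have "sc u < t" "u < sc u" using is_lim_sc[OF t u(2)] sc_greater[OF u(2)] by auto
  ultimately show "\<exists>d\<ge>g. d < t \<and> vtape (R d) FB 0" using u(1) by (meson less_imp_le less_trans)
qed

text \<open>Two flashes after \<open>g\<close> are used: the first may rest on marks older than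
  \<open>g\<close>, but the second rests on observations made after the first.\<close>

lemma flag_A_recurrent:
  assumes t: "is_lim t" and A: "vtape (R t) FA 0" and x: "x < n" "Pos a x"
  shows "vtape (R t) (Tp False a) x"
  unfolding lim_tape[OF t] limsup_at_def
proof (intro allI impI)
  fix g assume g: "g < t"
  obtain u where u: "g \<le> u" "u < t" "flash (R u)" using flag_A_flash[OF A g] by blast
  obtain v where v: "sc u \<le> v" "v < t" "flash (R v)" using flag_A_flash[OF A is_lim_sc[OF t u(2)]] by blast
  have uv: "u < v" using sc_greater[OF u(2)] v(1) by simp
  have "vtape (R v) (Sn a) x \<or> vtape (R v) (Tp False a) x"
    using v(3) x unfolding flash_def good_iff by blast
  then show "\<exists>d\<ge>g. d < t \<and> vtape (R d) (Tp False a) x"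
    using seen_since_flash[OF u(3) x(1) uv] u uv v(2) by (meson le_less_trans less_imp_le less_trans)
qed

text \<open>If flashes stopped, marks would accumulate and, as only finitely many cells are
  required, be complete at some stage below \<open>t\<close>; with the gate open this is a
  flash.\<close>

lemma recurrent_flag_A:
  assumes t: "is_lim t" and rec: "\<And>a x. x < n \<Longrightarrow> Pos a x \<Longrightarrow> vtape (R t) (Tp False a) x"
    and gate: "g0 < t" "\<And>u. g0 \<le> u \<Longrightarrow> u < t \<Longrightarrow> gate (R u)"
  shows "vtape (R t) FA 0"
proof (rule ccontr)
  assume "\<not> vtape (R t) FA 0"
  then obtain g1 where g1: "g1 < t" "\<And>u. g1 \<le> u \<Longrightarrow> u < t \<Longrightarrow> \<not> vtape (R u) FA 0"
    unfolding lim_tape[OF t] limsup_at_def by blast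
  define g where "g = max g0 g1"
  have g: "g < t" using g1 gate by (simp add: g_def)
  have nf: "\<not> flash (R u)" if "g \<le> u" "u < t" for u
  proof -
    have "g1 \<le> sc u" using that(1) sc_greater[OF that(2)] by (auto simp: g_def)
    then show ?thesis
      using g1(2)[of "sc u"] is_lim_sc[OF t that(2)] by (simp add: sc_tape[OF that(2)] next_tape_def)
  qed
  \<comment> \<open>Without flashes no mark is erased, and a mark passes to limits because it is
    present on a final segment below them.\<close>
  have keep: "v < t \<longrightarrow> u \<le> v \<longrightarrow> vtape (R v) (Sn a) x"
    if u: "g \<le> u" "vtape (R u) (Sn a) x" "x < n" for u v a x
  proof (induction v rule: time_induct)
    case (zero v)
    then show ?case using u by (metis order_le_less)
  next
    case (succ s)
    show ?case
    proof (intro impI)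
      assume s: "sc s < t" "u \<le> sc s"
      show "vtape (R (sc s)) (Sn a) x"
      proof (cases "u = sc s")
        case False
        then have "u \<le> s" using s less_sc_le by (metis order_le_less)
        moreover have "s < t" using s succ(1) by simp
        ultimately have "vtape (R s) (Sn a) x" "\<not> flash (R s)" using succ u nf by auto
        then show ?thesis using u by (simp add: sc_tape[OF succ(1)] next_tape_def)
      qed (use u in simp)
    qed
  next
    case (lim v)
    show ?case
    proof (intro impI)
      assume v: "v < t" "u \<le> v"
      show "vtape (R v) (Sn a) x"
      proof (cases "u = v")
        case False
        then have "u < v" using v by simp
        then show ?thesis
          unfolding lim_tape[OF lim(1)] limsup_at_def using lim(2) v
          by (metis less_trans linorder_le_cases max.absorb1 max.absorb2 max_less_iff_conj order_refl)
      qed (use u in simp)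
    qed
  qed
  \<comment> \<open>The required cells are marked one after another, each at a recurrence after the
    earlier ones; \<open>keep\<close> preserves the marks already made.\<close>
  have seen: "\<exists>v\<ge>g. v < t \<and> (\<forall>(a, x)\<in>F. vtape (R v) (Sn a) x)"
    if "finite F" "\<forall>(a, x)\<in>F. x < n \<and> Pos a x" for F :: "(three \<times> nat) set"
    using that
  proof (induction F rule: finite_induct)
    case empty
    then show ?case using g by auto
  next
    case (insert p F)
    obtain a x where p: "p = (a, x)" by (cases p)
    obtain v where v: "g \<le> v" "v < t" "\<forall>(a, x)\<in>F. vtape (R v) (Sn a) x" using insert by auto
    have x: "x < n" "Pos a x" using insert.prems p by auto
    obtain u where u: "v < u" "u < t" "vtape (R u) (Tp False a) x"
      using lim_tapeE[OF t rec[OF x] v(2)] by blast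
    have su: "sc u < t" "u < sc u" using is_lim_sc[OF t u(2)] sc_greater[OF u(2)] by auto
    have "vtape (R (sc u)) (Sn a) x"
      using nf[of u] u v x by (simp add: sc_tape[OF u(2)] next_tape_def)
    moreover have "vtape (R (sc u)) (Sn b) y" if "(b, y) \<in> F" for b y
    proof -
      have "y < n" "vtape (R v) (Sn b) y" using that insert.prems v(3) by auto
      moreover have "v \<le> sc u" using su u(1) by simp
      ultimately show ?thesis using keep[OF v(1), of b y "sc u"] su(1) by blast
    qed
    ultimately show ?case using su u(1) v(1) p by (intro exI[of _ "sc u"]) auto
  qed
  have "finite {(a, x). x < n \<and> Pos a x}"
    by (rule finite_subset[of _ "UNIV \<times> {..<n}"]) auto
  from seen[OF this]
  obtain v where "g \<le> v" "v < t" "\<forall>(a, x)\<in>{(a, x). x < n \<and> Pos a x}. vtape (R v) (Sn a) x"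
    by auto
  then have v: "g \<le> v" "v < t" "\<And>a x. x < n \<Longrightarrow> Pos a x \<Longrightarrow> vtape (R v) (Sn a) x" by auto
  then have "good (R v)" unfolding good_iff by blast
  moreover have "gate (R v)" using gate v by (simp add: g_def)
  ultimately show False using nf[OF v(1,2)] by (simp add: flash_def)
qed

lemma gate_persists: "gate (R u) \<Longrightarrow> u < t \<Longrightarrow> vtape (R t) FD 0"
proof (induction t rule: time_induct)
  case (zero t)
  then show ?case by simp
next
  case (succ s)
  have "gate (R s)"
  proof (cases "u = s")
    case False
    then have "u < s" using succ.prems(2) less_sc_le by (metis order_le_less)
    then show ?thesis using succ unfolding gate_iff by blast
  qed (use succ in simp)
  then show ?case by (simp add: sc_tape[OF succ(1)] next_tape_def)
next
  case (lim t)
  show ?case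
    unfolding lim_tape[OF lim(1)] limsup_at_def
  proof (intro allI impI)
    fix g assume g: "g < t"
    let ?d = "max g (sc u)"
    have "?d < t" "u < ?d" using g is_lim_sc[OF lim(1,4)] sc_greater[OF lim(4)] by (auto simp: less_max_iff_disj)
    then show "\<exists>d\<ge>g. d < t \<and> vtape (R d) FD 0" using lim.IH[of ?d] lim.prems by (intro exI[of _ ?d]) auto
  qed
qed

lemma gate_origin: "vtape (R t) FD 0 \<Longrightarrow> \<exists>u<t. G (fst (R u) True)"
proof (induction t rule: time_induct)
  case (zero t)
  then show ?case by (simp add: zero_tape)
next
  case (succ s)
  then have "gate (R s)" by (simp add: sc_tape[OF succ(1)] next_tape_def)
  then have "G (fst (R s) True) \<or> vtape (R s) FD 0" unfolding gate_iff by blast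
  then show ?case using succ by (meson less_trans)
next
  case (lim t)
  obtain g where "g < t" using lim(1) unfolding is_lim_def by blast
  then obtain v where "v < t" "vtape (R v) FD 0" using lim_tapeE[OF lim(1,3)] by blast
  then show ?case using lim.IH by (meson less_trans)
qed

end

section \<open>From the flags to a one-tape clock\<close>

context watcher
begin

text \<open>A step never introduces \<open>Boot\<close>; only a rewinding control that already holds
  it would return to it, and this is excluded.\<close>

lemma kd_not_Boot: "\<not> (fst q \<and> fst (snd q) = Boot) \<Longrightarrow> fst (snd (snd (snd (kd q c)))) \<noteq> Boot"
  by (cases "(q, c)" rule: kd.cases) (auto simp: Let_def split: prod.splits)

lemma fst_kstep: "fst (kstep c) = snd (snd (kd (fst c) (\<lambda>i. snd (snd c) i (fst (snd c)))))"
  by (cases c) (simp add: col_step_def split: prod.splits)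

text \<open>\<open>w\<close> is the expected reading of \<open>A\<close>, or of \<open>A\<close> and
  \<open>B\<close>; its length is the number of steps taken after the limit.\<close>

lemma watcher_clockable:
  fixes R :: "'a::wellorder \<Rightarrow> vconfig"
  assumes valid: "\<And>\<theta>. valid_program 3 (m \<theta>) (pr \<theta>)"
    and R: "trun (vstart start_state (\<lambda>_. False)) vstep vcell (vstart limit_state) R"
    and lam: "is_lim lam" and w: "w \<noteq> []" "length w \<le> 2"
    and now: "map (\<lambda>d. vtape (R lam) d 0) (take (length w) [FA, FB]) = w"
    and before: "\<And>t. t < lam \<Longrightarrow> is_lim t \<Longrightarrow> map (\<lambda>d. vtape (R t) d 0) (take (length w) [FA, FB]) \<noteq> w"
    and chain: "\<forall>j<length w. (sc ^^ j) lam < (sc ^^ Suc j) lam"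
  shows "one_tape_clockable ((sc ^^ length w) lam)"
proof -
  let ?s0 = "(False, Boot, \<lambda>_. start_state) :: control" and ?sl = "(False, Boot, \<lambda>_. limit_state) :: control"
  obtain R2 :: "'a \<Rightarrow> _" where R2: "trun (col_start ?s0 (\<lambda>_. False)) kstep col_cell (col_start ?sl) R2"
    using trun_exists[of "col_start ?s0 (\<lambda>_. False)" kstep col_cell "col_start ?sl"] by blast
  let ?k = "card (UNIV :: tape set)"
  \<comment> \<open>The tapes of \<open>A\<close> and \<open>B\<close> come first in the
    enumeration, so the first symbols read after a limit are the flags.\<close>
  obtain idx where idx: "bij_betw idx (UNIV :: tape set) {..<?k}"
    and idx': "\<And>i. i < length [Dat FA, Dat FB] \<Longrightarrow> idx ([Dat FA, Dat FB] ! i) = i"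
    by (rule enumerate_finite_set[of "UNIV :: tape set" "[Dat FA, Dat FB]"]) auto
  define nm where "nm = inv idx"
  have inj: "inj idx" using idx by (simp add: bij_betw_def)
  have "idx (Dat FA) = 0" "idx (Dat FB) = 1" using idx'[of 0] idx'[of 1] by simp_all
  then have nm: "nm 0 = Dat FA" "nm 1 = Dat FB"
    using inv_f_f[OF inj, of "Dat FA"] inv_f_f[OF inj, of "Dat FB"] by (simp_all add: nm_def)
  have k2: "2 \<le> ?k" using card_mono[of "UNIV :: tape set" "{Dat FA, Dat FB}"] by simp
  have cols: "map (\<lambda>j. f (nm j)) [0..<length w] = map (\<lambda>d. f (Dat d)) (take (length w) [FA, FB])" for f :: "tape \<Rightarrow> bool"
  proof -
    have "length w = 1 \<or> length w = 2" using w by (cases w) (auto simp: le_Suc_eq)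
    then show ?thesis using nm by (auto simp: upt_rec)
  qed
  interpret interleave ?k idx nm kd ?s0 ?sl w
  proof
    show "idx (nm j) = j" if "j < ?k" for j
      using idx that unfolding nm_def bij_betw_def by (metis f_inv_into_f lessThan_iff)
    show "nm (idx i) = i" for i unfolding nm_def by (rule inv_f_f[OF inj])
    show "idx i < ?k" for i using idx bij_betw_apply by fastforce
  qed (use w k2 in auto)
  define F where "F = {Boot} \<union> (\<lambda>(x, g, b). Obs x g b) ` ({..n} \<times> UNIV) \<union> range (\<lambda>(g, b). Wr g b) \<union>
    (\<lambda>(f, x). Upd f x) ` (UNIV \<times> {..n}) \<union> range Find \<union> range Place"
  let ?M = "{s :: bool \<Rightarrow> nat. \<forall>\<theta>. s \<theta> < m \<theta>}"
  have "?M \<subseteq> (\<lambda>(a, b) \<theta>. if \<theta> then a else b) ` ({..<m True} \<times> {..<m False})"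
  proof
    fix s assume "s \<in> ?M"
    moreover have "s = (\<lambda>\<theta>. if \<theta> then s True else s False)" by auto
    ultimately show "s \<in> (\<lambda>(a, b) \<theta>. if \<theta> then a else b) ` ({..<m True} \<times> {..<m False})"
      by (intro image_eqI[of _ _ "(s True, s False)"]) auto
  qed
  then have "finite ?M" by (rule finite_subset) simp
  then have finS: "finite (UNIV \<times> F \<times> ?M :: control set)"
    unfolding F_def by (intro finite_cartesian_product) auto
  have phF: "Boot \<in> F" "Obs x g b \<in> F \<longleftrightarrow> x \<le> n" "Wr g b \<in> F" "Upd f x \<in> F \<longleftrightarrow> x \<le> n" "Find \<theta> \<in> F" "Place \<theta> \<in> F"
    for x g b f \<theta> by (auto simp: F_def image_iff)
  have v3: "3 \<le> m \<theta>" "q < m \<theta> \<Longrightarrow> snd (snd (pr \<theta> q [b0, b1, b2])) < m \<theta>" for \<theta> q b0 b1 b2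
    using valid[of \<theta>] unfolding valid_program_def by auto
  have closed: "snd (snd (kd q c)) \<in> UNIV \<times> F \<times> ?M" if "q \<in> UNIV \<times> F \<times> ?M" for q c
  proof -
    obtain r f s where q: "q = (r, f, s)" by (metis prod_cases3)
    then have f: "f \<in> F" and s: "\<And>\<theta>. s \<theta> < m \<theta>" using that by auto
    have out: "pr \<theta> (s \<theta>) [b0, b1, b2] = (w, r, q') \<Longrightarrow> q' < m \<theta>" for \<theta> b0 b1 b2 w r q'
      using v3(2)[OF s[of \<theta>], of b0 b1 b2] by simp
    obtain r' f' s' where e: "snd (snd (kd q c)) = (r', f', s')" by (metis prod_cases3)
    have "f' \<in> F"
      using e f n_pos by (cases "(q, c)" rule: kd.cases) (auto simp: q phF Let_def split: if_splits prod.splits)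
    moreover have "s' \<theta> < m \<theta>" for \<theta>
      using e s out by (cases "(q, c)" rule: kd.cases) (auto simp: q Let_def split: if_splits prod.splits)
    ultimately show ?thesis unfolding e by simp
  qed
  have noBoot: "\<not> (fst (fst (R2 t)) \<and> fst (snd (fst (R2 t))) = Boot)" for t
  proof (induction t rule: time_induct)
    case (succ t)
    then show ?case using kd_not_Boot unfolding trun_sc[OF R2 succ(1)] fst_kstep by blast
  qed (simp_all add: trun_zero[OF R2] trun_lim[OF R2] col_start_def)
  \<comment> \<open>The interleaving compares with \<open>w\<close> whenever the control is
    \<open>?sl\<close>. This happens at limits only: no step enters \<open>Boot\<close>, and the
    start control carries different thread states.\<close>
  have Boot_lim: "is_lim t \<and> fst (snd (R2 t)) = 0" if "fst (R2 t) = ?sl" for t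
  proof (cases t rule: time_cases)
    case zero
    have "fst (R2 t) = ?s0" using trun_zero[OF R2 zero] by (simp add: col_start_def)
    then show ?thesis using that by (auto simp: fun_eq_iff start_state_def limit_state_def)
  next
    case (succ s)
    have "fst (snd (fst (R2 t))) \<noteq> Boot"
      unfolding succ(2) trun_sc[OF R2 succ(1)] fst_kstep by (rule kd_not_Boot[OF noBoot[of s]])
    then show ?thesis using that by simp
  next
    case lim
    then show ?thesis using trun_lim[OF R2 lim] by (simp add: col_start_def)
  qed
  have ref: "col_cell (R2 t) (Dat d, x) = vtape (R t) d x" if "is_lim t" for t d x
    by (rule watcher_refinement[OF R R2 that])
  show ?thesis
  proof (rule interleaved_clockable[OF R2 finS _ _ _ closed lam _ _ chain])
    show "map (\<lambda>j. col_cell (R2 lam) (nm j, 0)) [0..<length w] = w"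
      using now cols[of "\<lambda>i. col_cell (R2 lam) (i, 0)"] ref[OF lam] by simp
    show "map (\<lambda>j. col_cell (R2 t) (nm j, fst (snd (R2 t)))) [0..<length w] \<noteq> w"
      if "t < lam" "fst (R2 t) = ?sl" for t
      using before[OF that(1)] cols[of "\<lambda>i. col_cell (R2 t) (i, 0)"] Boot_lim[OF that(2)] ref[of t] by simp
    have "start_state < m \<theta>" "limit_state < m \<theta>" for \<theta>
      using v3(1)[of \<theta>] by (auto simp: start_state_def limit_state_def)
    then show "?s0 \<in> UNIV \<times> F \<times> ?M" "?sl \<in> UNIV \<times> F \<times> ?M" using phF(1) by auto
  qed (auto simp: fun_eq_iff start_state_def limit_state_def)
qed

end

section \<open>Gaps\<close>

text \<open>After \<open>j\<close> steps from cell 0 the head is at cell \<open>j\<close> at most,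
  so \<open>n\<close> steps read only the first \<open>n\<close> columns.\<close>

lemma steps_local:
  assumes agree: "\<forall>i<3. \<forall>x<n. T i x = T' i x" and j: "j \<le> n"
    and X_def: "X = (\<lambda>j. (ittm_step 3 P ^^ j) (q, 0, T))" and Y_def: "Y = (\<lambda>j. (ittm_step 3 P ^^ j) (q, 0, T'))"
  shows "fst (X j) = fst (Y j) \<and> fst (snd (X j)) = fst (snd (Y j)) \<and> fst (snd (X j)) \<le> j \<and>
    (\<forall>i<3. \<forall>x<n. snd (snd (X j)) i x = snd (snd (Y j)) i x)"
  using j
proof (induction j)
  case 0
  then show ?case using agree by (simp add: X_def Y_def)
next
  case (Suc j)
  obtain s h U where x: "X j = (s, h, U)" by (metis prod_cases3)
  obtain U' where y: "Y j = (s, h, U')" using Suc x by (cases "Y j") auto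
  have h: "h \<le> j" "h < n" and U: "\<And>i x. i < 3 \<Longrightarrow> x < n \<Longrightarrow> U i x = U' i x" using Suc x y by auto
  have e: "map (\<lambda>i. U i h) [0..<3] = map (\<lambda>i. U' i h) [0..<3]" using U h by auto
  obtain w r q' where o: "P s (map (\<lambda>i. U' i h) [0..<3]) = (w, r, q')" by (metis prod_cases3)
  have "X (Suc j) = ittm_step 3 P (X j)" "Y (Suc j) = ittm_step 3 P (Y j)"
    by (simp_all add: X_def Y_def)
  then have "X (Suc j) = (if s = halt_state then (s, h, U)
      else (q', if r then Suc h else h - 1, \<lambda>i x. if i < 3 \<and> x = h then w ! i else U i x))"
    "Y (Suc j) = (if s = halt_state then (s, h, U')
      else (q', if r then Suc h else h - 1, \<lambda>i x. if i < 3 \<and> x = h then w ! i else U' i x))"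
    by (simp_all only: x y ittm_step_def e o prod.case)
  moreover have "h - 1 \<le> Suc j" using h by simp
  ultimately show ?case using U h by simp
qed

lemma nonsucc_not_halt: "is_run k P C \<Longrightarrow> nonsucc t \<Longrightarrow> fst (C t) \<noteq> halt_state"
  unfolding is_run_trun
  by (cases t rule: time_cases)
    (auto simp: trun_zero trun_lim init_config_def start_state_def limit_state_def halt_state_def
      nonsucc_def covers_iff)

section \<open>A computation that halts finitely many steps after a limit\<close>

locale clocked =
  fixes P :: program and C :: "'a::wellorder \<Rightarrow> config" and m n :: nat and lam :: 'a
  assumes valid: "valid_program 3 m P" and C_run: "is_run 3 P C" and lam: "is_lim lam" and n_pos: "0 < n"
    and chain: "\<forall>j<n. (sc ^^ j) lam < (sc ^^ Suc j) lam"
    and halts: "fst (C ((sc ^^ n) lam)) = halt_state"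
    and running: "\<And>t. t < (sc ^^ n) lam \<Longrightarrow> fst (C t) \<noteq> halt_state"
begin

lemma lam_less: "t \<le> lam \<Longrightarrow> t < (sc ^^ n) lam"
proof -
  have "j \<le> n \<Longrightarrow> 0 < j \<Longrightarrow> lam < (sc ^^ j) lam" for j
  proof (induction j)
    case (Suc j)
    then show ?case using chain by (cases "j = 0") (auto intro: less_trans)
  qed simp
  then show "t \<le> lam \<Longrightarrow> t < (sc ^^ n) lam" using n_pos by (meson le_less_trans order_refl)
qed

text \<open>Otherwise the machine would halt within \<open>n\<close> steps of \<open>t\<close>,
  which is still below \<open>lam\<close>.\<close>

lemma earlier_limit_differs:
  assumes t: "is_lim t" "t < lam"
  shows "\<not> (\<forall>i<3. \<forall>x<n. snd (snd (C t)) i x = snd (snd (C lam)) i x)"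
proof
  assume agree: "\<forall>i<3. \<forall>x<n. snd (snd (C t)) i x = snd (snd (C lam)) i x"
  note run' = C_run[unfolded is_run_trun]
  have c: "C u = (limit_state, 0, snd (snd (C u)))" if "is_lim u" for u
    using trun_lim[OF run' that] by (metis snd_conv)
  have "C ((sc ^^ n) t) = (ittm_step 3 P ^^ n) (C t)" by (rule trun_iter[OF run' lam t(2)])
  moreover have "C ((sc ^^ n) lam) = (ittm_step 3 P ^^ n) (C lam)" by (rule trun_iter_chain[OF run' chain order_refl])
  ultimately have "fst (C ((sc ^^ n) t)) = fst (C ((sc ^^ n) lam))"
    using steps_local[OF agree order_refl refl refl, of P limit_state] c[OF t(1)] c[OF lam] by metis
  moreover have "(sc ^^ n) t < (sc ^^ n) lam"
    using iter_sc_lim[OF lam t(2)] lam_less by (meson less_imp_le)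
  ultimately show False using running halts by metis
qed

text \<open>A cell with limsup 0 is eventually 0, and the finitely many bounds for the first
  \<open>n\<close> columns have a maximum below \<open>lam\<close>.\<close>

lemma eventually_zero:
  "\<exists>g<lam. \<forall>u i x. g \<le> u \<and> u < lam \<longrightarrow> i < 3 \<and> x < n \<longrightarrow>
     \<not> snd (snd (C lam)) i x \<longrightarrow> \<not> snd (snd (C u)) i x"
proof -
  note run' = C_run[unfolded is_run_trun]
  have one: "\<exists>g<lam. \<forall>u. g \<le> u \<and> u < lam \<longrightarrow> \<not> snd (snd (C u)) i x" if "\<not> snd (snd (C lam)) i x" for i x
    using that unfolding trun_lim[OF run' lam] by (auto simp: limsup_at_def)
  have all: "\<exists>g<lam. \<forall>(i, x)\<in>F. \<forall>u. g \<le> u \<and> u < lam \<longrightarrow> \<not> snd (snd (C u)) i x"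
    if "finite F" "\<forall>(i, x)\<in>F. \<not> snd (snd (C lam)) i x" for F
    using that
  proof (induction F rule: finite_induct)
    case empty
    then show ?case using lam by (auto simp: is_lim_def)
  next
    case (insert p F)
    obtain i x where p: "p = (i, x)" by (cases p)
    obtain g1 where g1: "g1 < lam" "\<forall>(i, x)\<in>F. \<forall>u. g1 \<le> u \<and> u < lam \<longrightarrow> \<not> snd (snd (C u)) i x"
      using insert by auto
    obtain g2 where g2: "g2 < lam" "\<forall>u. g2 \<le> u \<and> u < lam \<longrightarrow> \<not> snd (snd (C u)) i x"
      using one[of i x] insert.prems p by auto
    show ?case using g1 g2 by (intro exI[of _ "max g1 g2"]) (auto simp: p)
  qed
  have "finite {(i, x). i < 3 \<and> x < n \<and> \<not> snd (snd (C lam)) i x}"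
    by (rule finite_subset[of _ "{..<3} \<times> {..<n}"]) auto
  from all[OF this] show ?thesis by auto
qed

definition Pos :: "three \<Rightarrow> nat \<Rightarrow> bool" where "Pos a x = snd (snd (C lam)) (t3 a) x"

lemma less_three: "i < 3 \<longleftrightarrow> (\<exists>a. i = t3 a)"
proof
  assume "i < 3"
  then have "i = t3 A0 \<or> i = t3 A1 \<or> i = t3 A2" by auto
  then show "\<exists>a. i = t3 a" by blast
next
  assume "\<exists>a. i = t3 a"
  then obtain a where "i = t3 a" by blast
  then show "i < 3" by (cases a) auto
qed

lemma tape_agrees:
  fixes R :: "'a \<Rightarrow> vconfig"
  assumes R: "watcher_run pr n Pos G R" and pr: "pr False = P" and t: "t \<le> lam"
  shows "watcher.vtape (R t) (Tp False a) x = snd (snd (C t)) (t3 a) x"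
proof -
  interpret watcher_run pr n Pos G R by (rule R)
  have "\<forall>u<t. fst (C u) \<noteq> halt_state" using running lam_less[OF t] by (meson less_trans)
  then show ?thesis using thread_agrees[of False C t] C_run pr by simp
qed

lemma no_match:
  fixes R :: "'a \<Rightarrow> vconfig"
  assumes R: "watcher_run pr n Pos G R" and pr: "pr False = P" and t: "is_lim t" "t < lam"
  obtains a x where "x < n" "watcher.vtape (R t) (Tp False a) x \<noteq> Pos a x"
  using earlier_limit_differs[OF t] tape_agrees[OF R pr less_imp_le[OF t(2)]] that
  unfolding less_three Pos_def by metis

text \<open>With \<open>?G\<close> constantly true the gate is always open, so at a limit
  \<open>A = 1\<close> and \<open>B = 0\<close> force the pattern, and \<open>lam\<close> is the
  first limit to show it.\<close>

lemma two_steps_one_tape: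
  assumes n2: "2 \<le> n"
  shows "one_tape_clockable ((sc ^^ 2) lam)"
proof -
  let ?pr = "\<lambda>_ :: bool. P" and ?G = "\<lambda>_ :: nat. True"
  interpret watcher ?pr n Pos ?G by unfold_locales (rule n_pos)
  obtain R :: "'a \<Rightarrow> vconfig" where R: "trun (vstart start_state (\<lambda>_. False)) vstep vcell (vstart limit_state) R"
    using trun_exists[of "vstart start_state (\<lambda>_. False)" vstep vcell "vstart limit_state"] by blast
  interpret watcher_run ?pr n Pos ?G R by unfold_locales (rule R)
  have wr: "watcher_run ?pr n Pos ?G R" by unfold_locales
  note tape = tape_agrees[OF wr refl]
  have match: "vtape (R t) (Tp False a) x = Pos a x"
    if "is_lim t" "vtape (R t) FA 0" "\<not> vtape (R t) FB 0" "x < n" for t a x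
    using flag_A_recurrent bad_flag_B that by blast
  have A: "vtape (R lam) FA 0"
  proof -
    obtain g where g: "g < lam" using lam by (auto simp: is_lim_def)
    show ?thesis
      by (rule recurrent_flag_A[OF lam _ g]) (simp_all add: tape Pos_def gate_iff)
  qed
  \<comment> \<open>\<open>B = 1\<close> at \<open>lam\<close> would need forbidden ones arbitrarily
    late below \<open>lam\<close>, against \<open>eventually_zero\<close>.\<close>
  have B: "\<not> vtape (R lam) FB 0"
  proof
    assume B: "vtape (R lam) FB 0"
    obtain g where g: "g < lam"
      "\<And>u i x. g \<le> u \<Longrightarrow> u < lam \<Longrightarrow> i < 3 \<Longrightarrow> x < n \<Longrightarrow> \<not> snd (snd (C lam)) i x \<Longrightarrow> \<not> snd (snd (C u)) i x"
      using eventually_zero by blast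
    obtain u where u: "g \<le> u" "u < lam" "bad (R u)" using flag_B_bad[OF B g(1)] by blast
    then obtain a x where "x < n" "\<not> Pos a x" "vtape (R u) (Tp False a) x" unfolding bad_iff by blast
    then show False using g(2)[OF u(1,2), of "t3 a" x] tape[of u a x] u(2) less_three by (auto simp: Pos_def)
  qed
  have "one_tape_clockable ((sc ^^ length [True, False]) lam)"
  proof (rule watcher_clockable[OF valid R lam])
    show "map (\<lambda>d. vtape (R t) d 0) (take (length [True, False]) [FA, FB]) \<noteq> [True, False]"
      if "t < lam" "is_lim t" for t
      using no_match[OF wr refl that(2,1)] match[OF that(2)] by auto
  qed (use A B chain n2 in auto)
  then show ?thesis by (simp add: numeral_2_eq_2)
qed

text \<open>The gate opens when the clock for \<open>b\<close> halts. A limit below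
  \<open>lam\<close> with \<open>A = 1\<close> thus lies above \<open>b\<close>, where the cells
  required to be 0 stay 0, so \<open>A\<close> alone identifies the pattern.\<close>

lemma one_step_one_tape:
  assumes b: "clockable b" "b < lam"
    and zero: "\<And>u i x. b \<le> u \<Longrightarrow> u < lam \<Longrightarrow> i < 3 \<Longrightarrow> x < n \<Longrightarrow>
      \<not> snd (snd (C lam)) i x \<Longrightarrow> \<not> snd (snd (C u)) i x"
  shows "one_tape_clockable (sc lam)"
proof -
  obtain l Q and D :: "'a \<Rightarrow> config" where Q: "valid_program 3 l Q" "is_run 3 Q D"
    and Dh: "fst (D b) = halt_state" "\<forall>t<b. fst (D t) \<noteq> halt_state"
    using b(1) unfolding clockable_def k_tape_clockable_def by blast
  let ?pr = "\<lambda>\<theta> :: bool. if \<theta> then Q else P" and ?G = "\<lambda>q :: nat. q = halt_state"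
  interpret watcher ?pr n Pos ?G by unfold_locales (rule n_pos)
  obtain R :: "'a \<Rightarrow> vconfig" where R: "trun (vstart start_state (\<lambda>_. False)) vstep vcell (vstart limit_state) R"
    using trun_exists[of "vstart start_state (\<lambda>_. False)" vstep vcell "vstart limit_state"] by blast
  interpret watcher_run ?pr n Pos ?G R by unfold_locales (rule R)
  have wr: "watcher_run ?pr n Pos ?G R" by unfold_locales
  have prF: "?pr False = P" by simp
  note tape = tape_agrees[OF wr prF]
  have q: "fst (R t) True = fst (D t)" if "t \<le> b" for t
    using thread_agrees[of True D t] Q(2) Dh(2) that by (simp add: less_le_trans)
  have gb: "gate (R u)" if "b \<le> u" for u
  proof (cases "u = b")
    case True
    then show ?thesis using q[of b] Dh(1) by (simp add: gate_iff)
  next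
    case False
    then have "b < u" using that by simp
    moreover have "gate (R b)" using q[of b] Dh(1) by (simp add: gate_iff)
    ultimately show ?thesis using gate_persists by (simp add: gate_iff)
  qed
  have A: "vtape (R lam) FA 0"
    by (rule recurrent_flag_A[OF lam _ b(2)]) (use gb in \<open>simp_all add: tape Pos_def\<close>)
  have match: "vtape (R t) (Tp False a) x = Pos a x"
    if t: "is_lim t" "t < lam" "vtape (R t) FA 0" "x < n" for t a x
  proof -
    obtain g where g: "g < t" using t(1) by (auto simp: is_lim_def)
    obtain u where u: "u < t" "flash (R u)" using flag_A_flash[OF t(3) g] by blast
    then have "gate (R u)" by (simp add: flash_def)
    then obtain v where v: "v \<le> u" "fst (R v) True = halt_state"
      using gate_origin[of u] unfolding gate_iff by (meson less_imp_le order_refl)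
    \<comment> \<open>Below \<open>b\<close> the clock thread follows \<open>D\<close>, which has
      not halted yet.\<close>
    have "b \<le> v"
    proof (rule ccontr)
      assume "\<not> b \<le> v"
      then have "v < b" by simp
      then show False using q[OF less_imp_le] v(2) Dh(2) by metis
    qed
    then have bt: "b < t" using v(1) u(1) by simp
    have "\<not> vtape (R t) (Tp False a) x" if np: "\<not> Pos a x"
    proof
      assume "vtape (R t) (Tp False a) x"
      then obtain y where y: "b < y" "y < t" "vtape (R y) (Tp False a) x" using lim_tapeE[OF t(1) _ bt] by blast
      have "y < lam" "b \<le> y" "t3 a < 3" using y t(2) less_three by auto
      then show False
        using zero[of y "t3 a" x] y(3) np tape[of y a x] t(4) by (simp add: Pos_def)
    qed
    then show ?thesis using flag_A_recurrent[OF t(1,3,4)] by blast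
  qed
  have valid': "valid_program 3 (if \<theta> then l else m) (?pr \<theta>)" for \<theta> using valid Q(1) by simp
  have "one_tape_clockable ((sc ^^ length [True]) lam)"
  proof (rule watcher_clockable[OF valid' R lam])
    show "map (\<lambda>d. vtape (R t) d 0) (take (length [True]) [FA, FB]) \<noteq> [True]" if "t < lam" "is_lim t" for t
      using no_match[OF wr prF that(2,1)] match[OF that(2,1)] by auto
  qed (use A chain n_pos in auto)
  then show ?thesis by simp
qed

end

lemma one_tape_clockable_iter:
  assumes "one_tape_clockable ((sc ^^ i) s)" "i \<le> n" "\<forall>j<n. (sc ^^ j) s < (sc ^^ Suc j) s"
  shows "one_tape_clockable ((sc ^^ n) s)"
  using assms(2,3)
proof (induction n)
  case 0
  then show ?case using assms(1) by simp
next
  case (Suc n)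
  show ?case
  proof (cases "i = Suc n")
    case False
    then have "one_tape_clockable ((sc ^^ n) s)" using Suc by simp
    moreover have "(sc ^^ n) s < (sc ^^ Suc n) s" using Suc.prems by blast
    ultimately show ?thesis using one_tape_clockable_sc by simp
  qed (use assms(1) in simp)
qed

theorem mainTheorem13:
  fixes \<alpha> :: "'a::wellorder"
  assumes "clockable \<alpha>" and "\<not> one_tape_clockable \<alpha>"
  shows "ends_gap \<alpha>"
proof -
  obtain m P and C :: "'a \<Rightarrow> config" where P: "valid_program 3 m P" "is_run 3 P C"
    and C: "fst (C \<alpha>) = halt_state" "\<forall>t<\<alpha>. fst (C t) \<noteq> halt_state"
    using assms(1) unfolding clockable_def k_tape_clockable_def by blast
  obtain lam n where nsl: "nonsucc lam" and \<alpha>: "\<alpha> = (sc ^^ n) lam"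
    and chain: "\<forall>j<n. (sc ^^ j) lam < (sc ^^ Suc j) lam"
    using time_decomp[of \<alpha>] by blast
  have n: "0 < n" using C(1) nonsucc_not_halt[OF P(2) nsl] \<alpha> by (cases n) auto
  have sc_lam: "lam < sc lam" using chain n by force
  \<comment> \<open>If \<open>lam\<close> were zero, stage 1 and hence every positive finite stage
    in the chain would be one-tape clockable.\<close>
  have lim: "is_lim lam"
  proof (rule ccontr)
    assume "\<not> is_lim lam"
    then have "one_tape_clockable ((sc ^^ 1) lam)"
      using one_tape_clockable_one[OF _ sc_lam] nsl by (simp add: is_lim_def)
    then show False using one_tape_clockable_iter[OF _ _ chain, of 1] n assms(2) \<alpha> by simp
  qed
  interpret clocked P C m n lam
    by unfold_locales (use P C \<alpha> chain lim n in auto)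
  have n1: "n = 1"
  proof (rule ccontr)
    assume "n \<noteq> 1"
    then have "2 \<le> n" using n by simp
    then show False using one_tape_clockable_iter[OF two_steps_one_tape _ chain] assms(2) \<alpha> by simp
  qed
  \<comment> \<open>The gap starts at \<open>g\<close>: a clockable \<open>b\<close> from there on
    could serve as the clock in \<open>one_step_one_tape\<close>.\<close>
  obtain g where g: "g < lam"
    "\<And>u i x. g \<le> u \<Longrightarrow> u < lam \<Longrightarrow> i < 3 \<Longrightarrow> x < n \<Longrightarrow> \<not> snd (snd (C lam)) i x \<Longrightarrow> \<not> snd (snd (C u)) i x"
    using eventually_zero by blast
  have "\<not> clockable b" if b: "g \<le> b" "b < \<alpha>" for b
  proof
    assume cb: "clockable b"
    then have "b \<noteq> lam" using nonsucc_not_halt nsl unfolding clockable_def k_tape_clockable_def by blast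
    moreover have "b \<le> lam" using b(2) \<alpha> n1 by (simp add: less_sc_le)
    ultimately have "b < lam" by simp
    then have "one_tape_clockable (sc lam)"
      using one_step_one_tape[OF cb] g(2) b(1) by (meson order_trans)
    then show False using assms(2) \<alpha> n1 by simp
  qed
  moreover have "g < \<alpha>" using lam_less g(1) \<alpha> by (meson less_imp_le)
  ultimately show ?thesis unfolding ends_gap_def using assms(1) by blast
qed

end
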